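(* Let $X$ be a real Banach space. The following conditions are equivalent: (1) $X$ is reflexive. (2) $X$ admits an equivalent renorming such that $X^{**}$ (with the corresponding bidual norm) is $\omega$-LUR. (3) $X$ admits an equivalent renorming such that (with respect to the corresponding bidual norm on $X^{**}$) the set $\Lambda\subset S_{X^{**}}$ given by $$\Lambda=\left\{\phi\in S_{X^{**}} \;\middle|\; \forall\, (\phi_n)_{n\in\mathbb{N}}\subset S_{X^{**}}:\ \sup_n\|\phi+\phi_n\|=2\ \Longrightarrow\ \phi\in[(\phi_n)_{n\in\mathbb{N}}]\right\}$$ satisfies $[\Lambda]=X^{**}$.
   Context: For a Banach space $Y$, $B_Y$ is the closed unit ball and $S_Y$ the unit sphere. $[A]$ denotes the norm-closed linear span of a set $A$ (and $[(\phi_n)_{n\in\mathbb N}]$ the closed linear span of the sequence). A Banach space $Y$ is $\omega$-LUR (weakly locally uniformly rotund) if for every $y\in S_Y$ and every sequence $(y_n)\subset B_Y$ with $\lim_{n\to\infty}\|y+y_n\|=2$ it holds that $y_n\to y$ in the weak topology of $Y$. *)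

theory Defs
  imports "HOL-Analysis.Analysis"
begin

text \<open>The map sending \<open>x\<close> to evaluation at \<open>x\<close> is \<open>blinfun.prod_left\<close> in the library.\<close>

definition canonical_embedding ::
    "'a::real_normed_vector \<Rightarrow> (('a \<Rightarrow>\<^sub>L real) \<Rightarrow>\<^sub>L real)" where
  "canonical_embedding = blinfun.prod_left"

lemma canonical_embedding_apply [simp]:
  "blinfun_apply (canonical_embedding x) f = blinfun_apply f x"
  by (simp add: canonical_embedding_def)

definition reflexive_space :: "'a::real_normed_vector itself \<Rightarrow> bool" where
  "reflexive_space (_ :: 'a itself) \<longleftrightarrow>
     surj (canonical_embedding :: 'a \<Rightarrow> (('a \<Rightarrow>\<^sub>L real) \<Rightarrow>\<^sub>L real))"

text \<open>
  A renorming is a function \<open>p\<close> on the fixed underlying space.  Definiteness of \<open>p\<close> follows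
  from the lower bound \<open>c * norm x \<le> p x\<close>.
\<close>

definition equivalent_norm :: "('a::real_normed_vector \<Rightarrow> real) \<Rightarrow> bool" where
  "equivalent_norm p \<longleftrightarrow>
     (\<forall>x y. p (x + y) \<le> p x + p y) \<and>
     (\<forall>a x. p (a *\<^sub>R x) = \<bar>a\<bar> * p x) \<and>
     (\<exists>c>0. \<exists>C>0. \<forall>x. c * norm x \<le> p x \<and> p x \<le> C * norm x)"

definition dual_norm ::
    "('a::real_normed_vector \<Rightarrow> real) \<Rightarrow> ('a \<Rightarrow>\<^sub>L real) \<Rightarrow> real" where
  "dual_norm p f = (SUP x\<in>{x. p x \<le> 1}. \<bar>blinfun_apply f x\<bar>)"

definition bidual_norm ::
    "('a::real_normed_vector \<Rightarrow> real) \<Rightarrow> (('a \<Rightarrow>\<^sub>L real) \<Rightarrow>\<^sub>L real) \<Rightarrow> real" where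
  "bidual_norm p = dual_norm (dual_norm p)"

text \<open>
  The bounded functionals, the weak topology and the closure of a set are the same for \<open>norm\<close>
  and for any equivalent norm, so below they are taken from the type, and only balls, spheres
  and values of the norm refer to \<open>p\<close>.  The dual norm of an equivalent norm is again
  equivalent, see \<open>equivalent_norm_dual_norm\<close>.
\<close>

definition weak_topology :: "'b::real_normed_vector topology" where
  "weak_topology =
     topology_generated_by {blinfun_apply f -` U | (f :: 'b \<Rightarrow>\<^sub>L real) U. open U}"

definition weakly_LUR :: "('b::real_normed_vector \<Rightarrow> real) \<Rightarrow> bool" where
  "weakly_LUR p \<longleftrightarrow>
     (\<forall>y ys. p y = 1 \<longrightarrow> (\<forall>n::nat. p (ys n) \<le> 1) \<longrightarrow>
        (\<lambda>n. p (y + ys n)) \<longlonglongrightarrow> 2 \<longrightarrow> limitin weak_topology ys y sequentially)"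

definition closed_span :: "'b::real_normed_vector set \<Rightarrow> 'b set" where
  "closed_span A = closure (span A)"

definition Lambda_set :: "('b::real_normed_vector \<Rightarrow> real) \<Rightarrow> 'b set" where
  "Lambda_set p =
     {\<phi>. p \<phi> = 1 \<and>
        (\<forall>\<phi>s :: nat \<Rightarrow> 'b. (\<forall>n. p (\<phi>s n) = 1) \<longrightarrow>
           (SUP n. p (\<phi> + \<phi>s n)) = 2 \<longrightarrow> \<phi> \<in> closed_span (range \<phi>s))}"

lemma equivalent_norm_dual_norm:
  fixes p :: "'a::real_normed_vector \<Rightarrow> real"
  assumes "equivalent_norm p"
  shows "equivalent_norm (dual_norm p)"
proof -
  from assms obtain c C where c: "c > 0" and C: "C > 0"
    and lo: "\<And>x. c * norm x \<le> p x" and hi: "\<And>x. p x \<le> C * norm x"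
    and hom: "\<And>a x. p (a *\<^sub>R x) = \<bar>a\<bar> * p x"
    unfolding equivalent_norm_def by blast
  let ?B = "{x. p x \<le> 1}"
  have p0: "p 0 = 0" using hom[of 0 0] by simp
  have ne: "?B \<noteq> {}" using p0 by (auto intro: exI[of _ 0])
  have up: "\<bar>blinfun_apply f x\<bar> \<le> norm f / c" if "x \<in> ?B" for f x
  proof -
    have "c * norm x \<le> 1" using lo[of x] that by simp
    then have "norm x \<le> 1 / c" using c by (simp add: field_simps)
    then have "norm f * norm x \<le> norm f * (1 / c)" by (rule mult_left_mono) simp
    then show ?thesis using norm_blinfun[of f x] by simp
  qed
  have bdd: "bdd_above ((\<lambda>x. \<bar>blinfun_apply f x\<bar>) ` ?B)" for f :: "'a \<Rightarrow>\<^sub>L real"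
    by (rule bdd_aboveI2[where M = "norm f / c"]) (erule up)
  have le: "\<bar>blinfun_apply f x\<bar> \<le> dual_norm p f" if "x \<in> ?B" for f x
    unfolding dual_norm_def by (rule cSUP_upper[OF that bdd])
  have dual_up: "dual_norm p f \<le> (1 / c) * norm f" for f
    unfolding dual_norm_def using up by (intro cSUP_least ne) auto
  have nonneg: "0 \<le> dual_norm p f" for f
    using le[of 0 f] p0 by simp
  have dual_lo: "(1 / C) * norm f \<le> dual_norm p f" for f
  proof -
    have "norm f \<le> C * dual_norm p f"
    proof (rule norm_blinfun_bound)
      show "0 \<le> C * dual_norm p f" using C nonneg by simp
      fix x
      show "norm (blinfun_apply f x) \<le> C * dual_norm p f * norm x"
      proof (cases "x = 0")
        case False
        let ?r = "1 / (C * norm x)"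
        have "p (?r *\<^sub>R x) \<le> 1"
          unfolding hom using hi[of x] C False by (simp add: field_simps)
        then have "\<bar>blinfun_apply f (?r *\<^sub>R x)\<bar> \<le> dual_norm p f" by (intro le) simp
        then have "?r * \<bar>blinfun_apply f x\<bar> \<le> dual_norm p f"
          using C by (simp add: blinfun.scaleR_right abs_mult)
        then show ?thesis using C False by (simp add: field_simps)
      qed simp
    qed
    then show ?thesis using C by (simp add: field_simps)
  qed
  have add: "dual_norm p (f + g) \<le> dual_norm p f + dual_norm p g" for f g
  proof -
    have "\<bar>blinfun_apply (f + g) x\<bar> \<le> dual_norm p f + dual_norm p g" if "x \<in> ?B" for x
      using le[OF that, of f] le[OF that, of g] by (simp add: blinfun.add_left)
    then show ?thesis
      by (subst dual_norm_def) (intro cSUP_least ne)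
  qed
  have scale_le: "dual_norm p (a *\<^sub>R f) \<le> \<bar>a\<bar> * dual_norm p f" for a f
  proof -
    have "\<bar>blinfun_apply (a *\<^sub>R f) x\<bar> \<le> \<bar>a\<bar> * dual_norm p f" if "x \<in> ?B" for x
      using le[OF that, of f] by (simp add: blinfun.scaleR_left abs_mult mult_left_mono)
    then show ?thesis
      by (subst dual_norm_def) (intro cSUP_least ne)
  qed
  have scale: "dual_norm p (a *\<^sub>R f) = \<bar>a\<bar> * dual_norm p f" for a f
  proof (cases "a = 0")
    case True
    then show ?thesis using scale_le[of a f] nonneg[of "a *\<^sub>R f"] by simp
  next
    case False
    have "dual_norm p f \<le> \<bar>inverse a\<bar> * dual_norm p (a *\<^sub>R f)"
      using scale_le[of "inverse a" "a *\<^sub>R f"] False by simp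
    then have "\<bar>a\<bar> * dual_norm p f \<le> dual_norm p (a *\<^sub>R f)"
      using False by (simp add: field_simps)
    with scale_le show ?thesis by (simp add: order_antisym)
  qed
  have "1 / c > 0" "1 / C > 0" using c C by simp_all
  then show ?thesis
    unfolding equivalent_norm_def using add scale dual_lo dual_up by blast
qed

end

theory Submission
  imports Defs
begin

text \<open>
  If \<open>\<Lambda>\<close> spans the bidual, then \<open>X\<close> is reflexive because \<open>\<Lambda> \<subseteq> X\<close>: every unit vector
  \<open>\<phi>\<close> of the bidual admits unit vectors \<open>x\<^sub>n\<close> of \<open>X\<close> with \<open>\<parallel>\<phi> + x\<^sub>n\<parallel> \<rightarrow> 2\<close>, so a \<open>\<phi> \<in> \<Lambda>\<close> lies in
  their closed span.  If the bidual norm is weakly LUR, then \<open>\<Lambda>\<close> is the whole sphere, since weak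
  limits stay in closed spans.

  The substance is that a reflexive space has an equivalent weakly LUR norm.  By Lindenstrauss, a
  reflexive space injects into some \<open>c0(F)\<close>; the proof is by induction on the density character.
  Well-order a set of generators, close each initial segment off under Skolem functions that choose
  norming functionals and almost norming vectors, and use reflexivity to get contractive projections
  onto the closed hulls.  The differences of consecutive projections form a \<open>c0\<close>-sequence and have
  ranges of smaller density, so the injections of these ranges can be combined.

  Given the coordinates \<open>F\<close>, add to the square of the norm a weighted sum of the squares of the
  seminorms \<open>sup {(\<Sum>f\<in>A. f(x)\<^sup>2)\<^bsup>1/2\<^esup> | A \<subseteq> F, card A \<le> n}\<close>.  If \<open>\<parallel>x + y\<^sub>k\<parallel> \<rightarrow> 2\<close>, then
  \<open>f(y\<^sub>k) \<rightarrow> f(x)\<close> for every \<open>f \<in> F\<close>, and by reflexivity \<open>F\<close> spans a dense subspace of the dual.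
\<close>

section \<open>The Hahn--Banach theorem\<close>

text \<open>A dominated partial functional is encoded by its graph, a subspace of \<open>'a \<times> real\<close>.  Domination
  by \<open>p\<close> with \<open>p 0 = 0\<close> already makes such a subspace single-valued.\<close>

lemma hahn_banach:
  fixes p :: "'a::real_vector \<Rightarrow> real" and G :: "('a \<times> real) set"
  assumes add: "\<And>x y. p (x + y) \<le> p x + p y"
    and hom: "\<And>t x. t \<ge> 0 \<Longrightarrow> p (t *\<^sub>R x) = t * p x"
    and G: "subspace G" and dom: "\<And>x a. (x, a) \<in> G \<Longrightarrow> a \<le> p x"
  obtains g where "linear g" "\<And>x. g x \<le> p x" "\<And>x a. (x, a) \<in> G \<Longrightarrow> g x = a"
proof -
  have p0: "p 0 = 0" using hom[of 0 0] by simp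
  define \<G> where "\<G> = {H. subspace H \<and> G \<subseteq> H \<and> (\<forall>x a. (x, a) \<in> H \<longrightarrow> a \<le> p x)}"
  have "\<exists>M\<in>\<G>. \<forall>X\<in>\<G>. M \<subseteq> X \<longrightarrow> X = M"
  proof (rule Zorn_Lemma2, rule ballI)
    fix C assume C: "C \<in> chains \<G>"
    show "\<exists>U\<in>\<G>. \<forall>X\<in>C. X \<subseteq> U"
    proof (cases "C = {}")
      case True
      then show ?thesis using G dom by (auto simp: \<G>_def)
    next
      case False
      have sub: "C \<subseteq> \<G>" and tot: "\<And>X Y. X \<in> C \<Longrightarrow> Y \<in> C \<Longrightarrow> X \<subseteq> Y \<or> Y \<subseteq> X"
        using C by (auto simp: chains_def chain_subset_def)
      have "subspace (\<Union>C)"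
      proof (rule subspaceI)
        show "0 \<in> \<Union>C" using False sub subspace_0 by (fastforce simp: \<G>_def)
      next
        fix x y assume "x \<in> \<Union>C" "y \<in> \<Union>C"
        then obtain X Y where XY: "X \<in> C" "x \<in> X" "Y \<in> C" "y \<in> Y" by blast
        then have "\<exists>Z\<in>C. x \<in> Z \<and> y \<in> Z" using tot by blast
        then show "x + y \<in> \<Union>C" using sub by (auto simp: \<G>_def intro: subspace_add)
      next
        fix c x assume "x \<in> \<Union>C"
        then show "c *\<^sub>R x \<in> \<Union>C" using sub unfolding \<G>_def by (blast intro: subspace_scale)
      qed
      moreover have "G \<subseteq> \<Union>C" using False sub by (auto simp: \<G>_def)
      moreover have "\<forall>x a. (x, a) \<in> \<Union>C \<longrightarrow> a \<le> p x" using sub by (auto simp: \<G>_def)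
      ultimately have "\<Union>C \<in> \<G>" by (simp add: \<G>_def)
      then show ?thesis by blast
    qed
  qed
  then obtain M where MG: "M \<in> \<G>" and max: "\<And>X. X \<in> \<G> \<Longrightarrow> M \<subseteq> X \<Longrightarrow> X = M" by blast
  have M: "subspace M" "G \<subseteq> M" and Mp: "\<And>x a. (x, a) \<in> M \<Longrightarrow> a \<le> p x"
    using MG by (auto simp: \<G>_def)
  have total: "\<exists>a. (x0, a) \<in> M" for x0
  proof -
    \<comment> \<open>A value \<open>c\<close> at \<open>x0\<close> extends \<open>M\<close> with
      domination iff it lies above every element of this set and below every
      \<open>p (y + x0) - b\<close>. Subadditivity puts each lower bound below each upper bound, so
      the supremum serves.\<close>
    let ?L = "{a - p (x - x0) | x a. (x, a) \<in> M}"
    have M0: "(0, 0) \<in> M" using subspace_0[OF M(1)] by (simp add: zero_prod_def)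
    have key: "a - p (x - x0) \<le> p (y + x0) - b" if "(x, a) \<in> M" "(y, b) \<in> M" for x a y b
    proof -
      have "a + b \<le> p (x + y)" using Mp subspace_add[OF M(1) that] by simp
      also have "\<dots> \<le> p (x - x0) + p (y + x0)" using add[of "x - x0" "y + x0"] by simp
      finally show ?thesis by simp
    qed
    define c where "c = Sup ?L"
    have bdd: "bdd_above ?L" using key[OF _ M0] by (intro bdd_aboveI[where M="p (0 + x0) - 0"]) auto
    have lo: "a - p (x - x0) \<le> c" if "(x, a) \<in> M" for x a
      unfolding c_def by (rule cSup_upper[OF _ bdd]) (use that in blast)
    have hi: "c \<le> p (y + x0) - b" if "(y, b) \<in> M" for y b
      unfolding c_def using M0 key[OF _ that] by (intro cSup_least) blast+
    let ?H = "span (insert (x0, c) M)"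
    have sM: "span M = M" using M(1) by (simp add: span_eq_iff)
    have "a \<le> p x" if xa: "(x, a) \<in> ?H" for x a
    proof -
      obtain k where "(x, a) - k *\<^sub>R (x0, c) \<in> M"
        using xa unfolding span_breakdown_eq sM by blast
      then have k: "(x - k *\<^sub>R x0, a - k * c) \<in> M" by simp
      \<comment> \<open>Rescaling by \<open>1/k\<close> or \<open>1/(-k)\<close> reduces to the
        coefficients 1 and -1 of \<open>x0\<close>, where the two bounds on \<open>c\<close>
        apply.\<close>
      consider "k = 0" | "k > 0" | "k < 0" by linarith
      then show ?thesis
      proof cases
        case 1 then show ?thesis using k Mp by simp
      next
        case 2
        have "c \<le> p ((1/k) *\<^sub>R (x - k *\<^sub>R x0) + x0) - (a - k * c) / k"
          using subspace_scale[OF M(1) k, of "1/k"] by (intro hi) simp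
        also have "(1/k) *\<^sub>R (x - k *\<^sub>R x0) + x0 = (1/k) *\<^sub>R x" using 2 by (simp add: algebra_simps)
        finally show ?thesis using 2 hom[of "1/k" x] by (simp add: field_simps)
      next
        case 3
        have "(a - k * c) / (-k) - p ((1/(-k)) *\<^sub>R (x - k *\<^sub>R x0) - x0) \<le> c"
          using subspace_scale[OF M(1) k, of "1/(-k)"] by (intro lo) simp
        also have "(1/(-k)) *\<^sub>R (x - k *\<^sub>R x0) - x0 = (1/(-k)) *\<^sub>R x"
          using 3 by (simp add: algebra_simps)
        finally show ?thesis using 3 hom[of "1/(-k)" x] by (simp add: field_simps)
      qed
    qed
    then have "?H \<in> \<G>" using M(2) span_superset[of "insert (x0, c) M"] by (auto simp: \<G>_def)
    then have "?H = M" using span_superset[of "insert (x0, c) M"] by (intro max) auto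
    then show ?thesis using span_superset[of "insert (x0, c) M"] by blast
  qed
  have uniq: "a = b" if "(x, a) \<in> M" "(x, b) \<in> M" for x a b
    using Mp[of 0 "a - b"] Mp[of 0 "b - a"] subspace_diff[OF M(1) that]
      subspace_diff[OF M(1) that(2,1)] p0 by simp
  define g where "g x = (SOME a. (x, a) \<in> M)" for x
  have g: "(x, g x) \<in> M" for x unfolding g_def using total by (rule someI_ex)
  show ?thesis
  proof
    show "linear g"
    proof (rule linearI)
      show "g (x + y) = g x + g y" for x y
        using subspace_add[OF M(1) g[of x] g[of y]] by (auto intro: uniq[OF g])
      show "g (c *\<^sub>R x) = c *\<^sub>R g x" for c x
        using subspace_scale[OF M(1) g[of x], of c] by (auto intro: uniq[OF g])
    qed
    show "g x \<le> p x" for x using Mp g by blast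
    show "g x = a" if "(x, a) \<in> G" for x a using uniq[OF g] that M(2) by blast
  qed
qed

text \<open>Symmetry of \<open>p\<close> turns the one-sided domination into a bound on the absolute
  value, and \<open>bound\<close> then makes the extension continuous.\<close>

lemma hahn_banach_blinfun:
  fixes p :: "'a::real_normed_vector \<Rightarrow> real" and G :: "('a \<times> real) set"
  assumes add: "\<And>x y. p (x + y) \<le> p x + p y"
    and hom: "\<And>t x. p (t *\<^sub>R x) = \<bar>t\<bar> * p x"
    and bound: "\<And>x. p x \<le> C * norm x"
    and G: "subspace G" and dom: "\<And>x a. (x, a) \<in> G \<Longrightarrow> a \<le> p x"
  obtains g :: "'a \<Rightarrow>\<^sub>L real"
  where "\<And>x. \<bar>blinfun_apply g x\<bar> \<le> p x" "\<And>x a. (x, a) \<in> G \<Longrightarrow> blinfun_apply g x = a"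
proof -
  have hom': "t \<ge> 0 \<Longrightarrow> p (t *\<^sub>R x) = t * p x" for t x using hom by simp
  obtain g where g: "linear g" "\<And>x. g x \<le> p x" "\<And>x a. (x, a) \<in> G \<Longrightarrow> g x = a"
    using hahn_banach[of p, OF add hom' G dom] by blast
  have abs: "\<bar>g x\<bar> \<le> p x" for x
    using g(2)[of x] g(2)[of "- x"] hom[of "-1" x] linear_neg[OF g(1), of x] by simp
  have "bounded_linear g"
    using g(1) abs bound
    by (intro bounded_linear.intro bounded_linear_axioms.intro exI[of _ C])
      (auto intro: order_trans simp: mult.commute)
  then show ?thesis using that[of "Blinfun g"] abs g(3) by (simp add: bounded_linear_Blinfun_apply)
qed

text \<open>Extends the functional with value \<open>t * p x\<close> at \<open>t *\<^sub>R x\<close>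
  from the line through \<open>x\<close>; its graph is \<open>span {(x, p x)}\<close>.\<close>

lemma seminorm_attaining_functional:
  fixes p :: "'a::real_normed_vector \<Rightarrow> real"
  assumes add: "\<And>x y. p (x + y) \<le> p x + p y"
    and hom: "\<And>t x. p (t *\<^sub>R x) = \<bar>t\<bar> * p x"
    and bound: "\<And>x. p x \<le> C * norm x"
  obtains f :: "'a \<Rightarrow>\<^sub>L real"
  where "\<And>z. \<bar>blinfun_apply f z\<bar> \<le> p z" "blinfun_apply f x = p x"
proof -
  have p0: "0 \<le> p z" for z using add[of z "- z"] hom[of "-1" z] hom[of 0 0] by simp
  have "a \<le> p z" if "(z, a) \<in> span {(x, p x)}" for z a
    using that p0[of x] by (auto simp: span_singleton hom intro!: mult_right_mono)
  then obtain f :: "'a \<Rightarrow>\<^sub>L real" where "\<And>z. \<bar>blinfun_apply f z\<bar> \<le> p z"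
    "\<And>z a. (z, a) \<in> span {(x, p x)} \<Longrightarrow> blinfun_apply f z = a"
    using hahn_banach_blinfun[of p C "span {(x, p x)}", OF add hom bound subspace_span] by blast
  then show ?thesis using that span_base[of "(x, p x)" "{(x, p x)}"] by blast
qed

lemma norm_attaining_functional:
  fixes x :: "'a::real_normed_vector"
  obtains f :: "'a \<Rightarrow>\<^sub>L real" where "norm f \<le> 1" "blinfun_apply f x = norm x"
proof -
  obtain f :: "'a \<Rightarrow>\<^sub>L real" where f: "\<And>z. \<bar>blinfun_apply f z\<bar> \<le> norm z" "blinfun_apply f x = norm x"
    by (rule seminorm_attaining_functional[of norm 1 x]) (auto intro: norm_triangle_ineq)
  then show ?thesis using that[of f] norm_blinfun_bound[of 1 f] by simp
qed

text \<open>Serves to apply the seminorm form of Hahn-Banach to the distance from \<open>A\<close>.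
  Near-optimal approximants in \<open>A\<close> are added or scaled; using the inverse scalar as
  well turns the scaling inequality into an equality.\<close>

lemma infdist_subspace:
  fixes A :: "'a::real_normed_vector set"
  assumes A: "subspace A"
  shows infdist_subspace_add: "infdist (x + y) A \<le> infdist x A + infdist y A"
    and infdist_subspace_scaleR: "infdist (t *\<^sub>R x) A = \<bar>t\<bar> * infdist x A"
proof -
  have ne: "A \<noteq> {}" using subspace_0[OF A] by blast
  have near: "\<exists>a\<in>A. dist x a < infdist x A + e" if "e > 0" for x e
    using cInf_lessD[of "dist x ` A" "infdist x A + e"] ne that by (auto simp: infdist_def)
  show "infdist (x + y) A \<le> infdist x A + infdist y A"
  proof (rule field_le_epsilon)
    fix e :: real assume "e > 0"
    then obtain a b where ab: "a \<in> A" "b \<in> A" "dist x a < infdist x A + e/2" "dist y b < infdist y A + e/2"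
      using near[of "e/2" x] near[of "e/2" y] by auto
    have "infdist (x + y) A \<le> dist (x + y) (a + b)" using ab A by (intro infdist_le subspace_add)
    also have "\<dots> \<le> dist x a + dist y b" by (rule dist_triangle_add)
    finally show "infdist (x + y) A \<le> infdist x A + infdist y A + e" using ab by linarith
  qed
  have le: "infdist (t *\<^sub>R x) A \<le> \<bar>t\<bar> * infdist x A" for t x
  proof (rule field_le_epsilon)
    fix e :: real assume e: "e > 0"
    obtain a where a: "a \<in> A" "dist x a < infdist x A + e / (\<bar>t\<bar> + 1)"
      using near[of "e/(\<bar>t\<bar>+1)" x] e by auto
    have "infdist (t *\<^sub>R x) A \<le> dist (t *\<^sub>R x) (t *\<^sub>R a)" using a A by (intro infdist_le subspace_scale)
    also have "\<dots> = \<bar>t\<bar> * dist x a" by (simp add: dist_norm flip: scaleR_diff_right)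
    also have "\<dots> \<le> \<bar>t\<bar> * (infdist x A + e / (\<bar>t\<bar> + 1))" using a by (intro mult_left_mono) auto
    also have "\<dots> \<le> \<bar>t\<bar> * infdist x A + e"
      using e by (simp add: algebra_simps divide_simps)
    finally show "infdist (t *\<^sub>R x) A \<le> \<bar>t\<bar> * infdist x A + e" .
  qed
  show "infdist (t *\<^sub>R x) A = \<bar>t\<bar> * infdist x A"
  proof (cases "t = 0")
    case True
    then show ?thesis using subspace_0[OF A] by simp
  next
    case False
    have "infdist x A \<le> \<bar>1/t\<bar> * infdist (t *\<^sub>R x) A" using le[of "1/t" "t *\<^sub>R x"] False by simp
    then have "\<bar>t\<bar> * infdist x A \<le> infdist (t *\<^sub>R x) A" using False by (simp add: field_simps)
    with le show ?thesis by (simp add: order_antisym)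
  qed
qed

text \<open>A functional that attains the distance seminorm at \<open>x\<close> vanishes on
  \<open>A\<close> because the distance does, and is nonzero at \<open>x\<close> because the
  distance is positive there.\<close>

lemma subspace_separating_functional:
  fixes A :: "'a::real_normed_vector set"
  assumes A: "subspace A" and x: "x \<notin> closure A"
  obtains f :: "'a \<Rightarrow>\<^sub>L real" where "\<And>a. a \<in> A \<Longrightarrow> blinfun_apply f a = 0" "blinfun_apply f x \<noteq> 0"
proof -
  have ne: "A \<noteq> {}" using subspace_0[OF A] by blast
  have "infdist z A \<le> 1 * norm z" for z
    using infdist_le[OF subspace_0[OF A], of z] by simp
  then obtain f :: "'a \<Rightarrow>\<^sub>L real"
    where f: "\<And>z. \<bar>blinfun_apply f z\<bar> \<le> infdist z A" "blinfun_apply f x = infdist x A"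
    using seminorm_attaining_functional[of "\<lambda>z. infdist z A" 1 x,
      OF infdist_subspace_add[OF A] infdist_subspace_scaleR[OF A]] by blast
  have "blinfun_apply f a = 0" if "a \<in> A" for a using f(1)[of a] that by simp
  moreover have "blinfun_apply f x \<noteq> 0" using f(2) x ne by (simp add: in_closure_iff_infdist_zero)
  ultimately show ?thesis using that by blast
qed

section \<open>Contractive projections in reflexive spaces\<close>

text \<open>The projections come from pairs \<open>(U, V)\<close> with \<open>U \<subseteq> Y\<close> and \<open>V\<close> a set of functionals that are
  almost norming for each other.  Such pairs are obtained from a set of generators by closing off
  under Skolem functions; terms make this closure finitary, so that it commutes with unions of
  chains.\<close>

definition norming_functional :: "'a::real_normed_vector \<Rightarrow> ('a \<Rightarrow>\<^sub>L real)" where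
  "norming_functional x =
     (if x = 0 then 0 else SOME f. norm f \<le> 1 \<and> blinfun_apply f x = norm x)"

lemma norming_functional:
  "norm (norming_functional x) \<le> 1" "blinfun_apply (norming_functional x) x = norm x"
proof -
  have "norm (norming_functional x) \<le> 1 \<and> blinfun_apply (norming_functional x) x = norm x"
  proof (cases "x = 0")
    case True
    then show ?thesis by (simp add: norming_functional_def)
  next
    case False
    obtain f :: "'a \<Rightarrow>\<^sub>L real" where "norm f \<le> 1 \<and> blinfun_apply f x = norm x"
      by (rule norm_attaining_functional) blast
    then show ?thesis
      unfolding norming_functional_def if_not_P[OF False] by (rule someI)
  qed
  then show "norm (norming_functional x) \<le> 1" "blinfun_apply (norming_functional x) x = norm x"
    by auto
qed

text \<open>The inequality says that \<open>w\<close> attains the norm of \<open>f\<close> on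
  \<open>Y\<close> up to \<open>1 / real (Suc k)\<close>. Sending the zero functional to 0, as
  \<open>norming_functional\<close> does with the zero vector, makes every term without generators
  evaluate to 0.\<close>

definition norming_vector :: "'a::real_normed_vector set \<Rightarrow> nat \<Rightarrow> ('a \<Rightarrow>\<^sub>L real) \<Rightarrow> 'a" where
  "norming_vector Y k f =
     (if f = 0 then 0 else SOME w. w \<in> Y \<and> norm w \<le> 1 \<and>
        (\<forall>y\<in>Y. \<bar>blinfun_apply f y\<bar> \<le> (\<bar>blinfun_apply f w\<bar> + 1 / real (Suc k)) * norm y))"

lemma norming_vector:
  assumes Y: "subspace Y"
  shows "norming_vector Y k f \<in> Y" "norm (norming_vector Y k f) \<le> 1"
    and "y \<in> Y \<Longrightarrow>
      \<bar>blinfun_apply f y\<bar> \<le> (\<bar>blinfun_apply f (norming_vector Y k f)\<bar> + 1 / real (Suc k)) * norm y"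
proof -
  let ?B = "{y \<in> Y. norm y \<le> 1}"
  let ?P = "\<lambda>w. w \<in> Y \<and> norm w \<le> 1 \<and>
    (\<forall>y\<in>Y. \<bar>blinfun_apply f y\<bar> \<le> (\<bar>blinfun_apply f w\<bar> + 1 / real (Suc k)) * norm y)"
  have "?P (norming_vector Y k f)"
  proof (cases "f = 0")
    case True
    then show ?thesis using subspace_0[OF Y] by (simp add: norming_vector_def)
  next
    case False
    let ?s = "SUP y\<in>?B. \<bar>blinfun_apply f y\<bar>"
    have ne: "?B \<noteq> {}" using subspace_0[OF Y] by (auto intro: exI[of _ 0])
    have "\<bar>blinfun_apply f y\<bar> \<le> norm f" if "y \<in> ?B" for y
    proof -
      have "norm f * norm y \<le> norm f * 1" using that by (intro mult_left_mono) auto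
      then show ?thesis using norm_blinfun[of f y] by simp
    qed
    then have bdd: "bdd_above ((\<lambda>y. \<bar>blinfun_apply f y\<bar>) ` ?B)" by (intro bdd_aboveI2)
    have "?s - 1 / real (Suc k) < ?s" by simp
    then obtain w where w: "w \<in> ?B" "?s - 1 / real (Suc k) < \<bar>blinfun_apply f w\<bar>"
      using less_cSUP_iff[OF ne bdd] by blast
    have "\<bar>blinfun_apply f y\<bar> \<le> (\<bar>blinfun_apply f w\<bar> + 1 / real (Suc k)) * norm y" if "y \<in> Y" for y
    proof (cases "y = 0")
      case True then show ?thesis by simp
    next
      case False
      have "(1 / norm y) *\<^sub>R y \<in> ?B" using that False subspace_scale[OF Y] by auto
      then have "\<bar>blinfun_apply f ((1 / norm y) *\<^sub>R y)\<bar> \<le> ?s" by (rule cSUP_upper[OF _ bdd])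
      then have "\<bar>blinfun_apply f y\<bar> / norm y \<le> ?s" by (simp add: blinfun.scaleR_right abs_mult)
      then have "\<bar>blinfun_apply f y\<bar> / norm y \<le> \<bar>blinfun_apply f w\<bar> + 1 / real (Suc k)" using w by linarith
      then show ?thesis using False by (simp add: pos_divide_le_eq)
    qed
    then have "?P w" using w by blast
    then show ?thesis unfolding norming_vector_def if_not_P[OF False] by (rule someI)
  qed
  then show "norming_vector Y k f \<in> Y" "norm (norming_vector Y k f) \<le> 1"
    and "y \<in> Y \<Longrightarrow>
      \<bar>blinfun_apply f y\<bar> \<le> (\<bar>blinfun_apply f (norming_vector Y k f)\<bar> + 1 / real (Suc k)) * norm y"
    by blast+
qed

text \<open>Scalars are rational to keep the number of terms over an infinite set at the cardinality
  of that set; real scalars come back in the closures.\<close>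

datatype 'a skolem_term =
    Null
  | Gen 'a
  | Add "'a skolem_term" "'a skolem_term"
  | Scale rat "'a skolem_term"
  | Functional "'a skolem_term"
  | Witness nat "'a skolem_term"

text \<open>Each term denotes a pair of a vector and a functional, so one kind of term serves both
  hulls; \<open>Functional\<close> and \<open>Witness\<close> cross from one component to the
  other.\<close>

primrec skolem_eval ::
    "'a::real_normed_vector set \<Rightarrow> 'a skolem_term \<Rightarrow> 'a \<times> ('a \<Rightarrow>\<^sub>L real)" where
  "skolem_eval Y Null = 0"
| "skolem_eval Y (Gen x) = (x, 0)"
| "skolem_eval Y (Add s t) = skolem_eval Y s + skolem_eval Y t"
| "skolem_eval Y (Scale q t) = of_rat q *\<^sub>R skolem_eval Y t"
| "skolem_eval Y (Functional t) = (0, norming_functional (fst (skolem_eval Y t)))"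
| "skolem_eval Y (Witness k t) = (norming_vector Y k (snd (skolem_eval Y t)), 0)"

definition vector_hull :: "'a::real_normed_vector set \<Rightarrow> 'a set \<Rightarrow> 'a set" where
  "vector_hull Y Z = {fst (skolem_eval Y t) | t. set_skolem_term t \<subseteq> Z}"

definition functional_hull :: "'a::real_normed_vector set \<Rightarrow> 'a set \<Rightarrow> ('a \<Rightarrow>\<^sub>L real) set" where
  "functional_hull Y Z = {snd (skolem_eval Y t) | t. set_skolem_term t \<subseteq> Z}"

lemma vector_hullI: "set_skolem_term t \<subseteq> Z \<Longrightarrow> fst (skolem_eval Y t) \<in> vector_hull Y Z"
  by (auto simp: vector_hull_def)

lemma functional_hullI: "set_skolem_term t \<subseteq> Z \<Longrightarrow> snd (skolem_eval Y t) \<in> functional_hull Y Z"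
  by (auto simp: functional_hull_def)

lemma hull_mono:
  assumes "Z \<subseteq> Z'"
  shows vector_hull_mono: "vector_hull Y Z \<subseteq> vector_hull Y Z'"
    and functional_hull_mono: "functional_hull Y Z \<subseteq> functional_hull Y Z'"
  using assms unfolding vector_hull_def functional_hull_def by blast+

lemma generators_subset_vector_hull: "Z \<subseteq> vector_hull Y Z"
proof
  fix x assume "x \<in> Z"
  then show "x \<in> vector_hull Y Z" using vector_hullI[of "Gen x" Z Y] by simp
qed

lemma norming_functional_in_hull: "x \<in> vector_hull Y Z \<Longrightarrow> norming_functional x \<in> functional_hull Y Z"
  unfolding vector_hull_def using functional_hullI[of "Functional t" Z Y for t] by auto

lemma norming_vector_in_hull: "f \<in> functional_hull Y Z \<Longrightarrow> norming_vector Y k f \<in> vector_hull Y Z"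
  unfolding functional_hull_def using vector_hullI[of "Witness k t" Z Y for t] by auto

text \<open>Without generators only zeros arise, since both Skolem functions send 0 to 0. This makes
  the projection of the empty initial segment vanish.\<close>

lemma vector_hull_empty: "vector_hull Y {} = {0}"
proof -
  have "skolem_eval Y t = 0" if "set_skolem_term t = {}" for t
    using that by (induction t) (auto simp: zero_prod_def norming_functional_def norming_vector_def)
  then have "vector_hull Y {} \<subseteq> {0}" by (auto simp: vector_hull_def)
  moreover have "0 \<in> vector_hull Y {}" using vector_hullI[of Null "{}" Y] by simp
  ultimately show ?thesis by blast
qed

lemma vector_hull_subset:
  assumes Y: "subspace Y" and Z: "Z \<subseteq> Y"
  shows "vector_hull Y Z \<subseteq> Y"
proof -
  have "fst (skolem_eval Y t) \<in> Y" if "set_skolem_term t \<subseteq> Z" for t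
    using that
  proof (induction t)
    case (Gen x) then show ?case using Z by auto
  qed (auto intro: subspace_0 subspace_add subspace_scale norming_vector Y)
  then show ?thesis by (auto simp: vector_hull_def)
qed

text \<open>A term mentions only finitely many generators, and these already lie in one member of
  the chain.\<close>

lemma vector_hull_Union_chain:
  assumes "subset.chain UNIV \<C>" "\<C> \<noteq> {}" "u \<in> vector_hull Y (\<Union>\<C>)"
  obtains C where "C \<in> \<C>" "u \<in> vector_hull Y C"
proof -
  obtain t where t: "u = fst (skolem_eval Y t)" "set_skolem_term t \<subseteq> \<Union>\<C>"
    using assms(3) by (auto simp: vector_hull_def)
  have "finite (set_skolem_term t)" by (induction t) auto
  then obtain C where "C \<in> \<C>" "set_skolem_term t \<subseteq> C"
    using finite_subset_Union_chain[OF _ t(2) assms(2,1)] by blast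
  then show ?thesis using that t(1) vector_hullI by blast
qed

text \<open>Sums pass to the closure by continuity in one variable at a time; real multiples are
  reached by density of the rationals, first for points of \<open>T\<close> and then for its
  closure.\<close>

lemma subspace_closure_rational:
  fixes T :: "'b::real_normed_vector set"
  assumes zero: "0 \<in> T" and add: "\<And>x y. x \<in> T \<Longrightarrow> y \<in> T \<Longrightarrow> x + y \<in> T"
    and scale: "\<And>q x. x \<in> T \<Longrightarrow> of_rat q *\<^sub>R x \<in> T"
  shows "subspace (closure T)"
proof (rule subspaceI)
  show "0 \<in> closure T" using zero closure_subset by blast
next
  fix x y assume x: "x \<in> closure T" and y: "y \<in> closure T"
  have 1: "x + y \<in> closure T" if "x \<in> closure T" "y \<in> T" for x y
  proof -
    have "(\<lambda>x. x + y) ` closure T \<subseteq> closure T"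
      using add that(2) closure_subset by (intro image_closure_subset continuous_intros) auto
    then show ?thesis using that by blast
  qed
  have "(\<lambda>y. x + y) ` closure T \<subseteq> closure T"
    using 1[OF x] by (intro image_closure_subset continuous_intros) auto
  then show "x + y \<in> closure T" using y by blast
next
  fix c :: real and x assume x: "x \<in> closure T"
  have 1: "c *\<^sub>R x \<in> closure T" if "x \<in> T" for x
  proof -
    have "(\<lambda>r. r *\<^sub>R x) ` closure \<rat> \<subseteq> closure T"
      using scale[OF that] closure_subset
      by (intro image_closure_subset continuous_intros) (auto elim!: Rats_cases)
    then show ?thesis by (auto simp: Rats_closure_real)
  qed
  have "(\<lambda>x. c *\<^sub>R x) ` closure T \<subseteq> closure T"
    using 1 by (intro image_closure_subset continuous_intros) auto
  then show "c *\<^sub>R x \<in> closure T" using x by blast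
qed

lemma subspace_closure_vector_hull: "subspace (closure (vector_hull Y Z))"
proof (rule subspace_closure_rational)
  show "0 \<in> vector_hull Y Z" using vector_hullI[of Null Z Y] by simp
  show "x + y \<in> vector_hull Y Z" if "x \<in> vector_hull Y Z" "y \<in> vector_hull Y Z" for x y
    using that vector_hullI[of "Add s t" Z Y for s t] by (auto simp: vector_hull_def)
  show "of_rat q *\<^sub>R x \<in> vector_hull Y Z" if "x \<in> vector_hull Y Z" for q x
    using that vector_hullI[of "Scale q t" Z Y for t] by (auto simp: vector_hull_def)
qed

lemma subspace_closure_functional_hull: "subspace (closure (functional_hull Y Z))"
proof (rule subspace_closure_rational)
  show "0 \<in> functional_hull Y Z" using functional_hullI[of Null Z Y] by simp
  show "x + y \<in> functional_hull Y Z" if "x \<in> functional_hull Y Z" "y \<in> functional_hull Y Z" for x y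
    using that functional_hullI[of "Add s t" Z Y for s t] by (auto simp: functional_hull_def)
  show "of_rat q *\<^sub>R x \<in> functional_hull Y Z" if "x \<in> functional_hull Y Z" for q x
    using that functional_hullI[of "Scale q t" Z Y for t] by (auto simp: functional_hull_def)
qed

text \<open>If \<open>u\<close> in the hull is close to \<open>x\<close>, the norming functional of
  \<open>u\<close> lies in the functional hull and kills \<open>x\<close>, so the norm of
  \<open>u\<close> is at most its distance to \<open>x\<close>. Both norms are therefore
  small.\<close>

lemma functional_hull_separates:
  assumes x: "x \<in> closure (vector_hull Y Z)"
    and zero: "\<And>f. f \<in> functional_hull Y Z \<Longrightarrow> blinfun_apply f x = 0"
  shows "x = 0"
proof -
  have "norm x \<le> 0 + e" if e: "e > 0" for e
  proof -
    obtain u where u: "u \<in> vector_hull Y Z" "dist u x < e / 2"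
      using x e unfolding closure_approachable by (meson half_gt_zero)
    let ?f = "norming_functional u"
    have "norm u = blinfun_apply ?f (u - x)"
      using zero[OF norming_functional_in_hull[OF u(1)]] norming_functional(2)[of u]
      by (simp add: blinfun.diff_right)
    also have "\<dots> \<le> norm ?f * norm (u - x)" using norm_blinfun[of ?f "u - x"] by simp
    also have "\<dots> \<le> 1 * norm (u - x)" by (intro mult_right_mono norming_functional) simp
    finally have "norm u < e / 2" using u(2) by (simp add: dist_norm)
    then show ?thesis using u(2) norm_triangle_ineq4[of u "u - x"] by (simp add: dist_norm)
  qed
  then have "norm x \<le> 0" by (rule field_le_epsilon)
  then show ?thesis by simp
qed

text \<open>Evaluation at \<open>y\<close> on the functional hull is dominated by the seminorm of restriction to the
  vector hull; a dominated extension to the dual space is, by reflexivity, evaluation at a vector,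
  and the domination puts this vector into the closed vector hull.\<close>

lemma ex_projection:
  fixes Y :: "'a::real_normed_vector set"
  assumes refl: "reflexive_space TYPE('a)" and Y: "subspace Y" and y: "y \<in> Y"
  shows "\<exists>x\<in>closure (vector_hull Y Z). norm x \<le> norm y \<and>
    (\<forall>f\<in>functional_hull Y Z. blinfun_apply f x = blinfun_apply f y)"
proof -
  let ?U = "closure (vector_hull Y Z)" and ?V = "closure (functional_hull Y Z)"
  let ?B = "{u \<in> ?U. norm u \<le> 1}"
  define s where "s f = (SUP u\<in>?B. \<bar>blinfun_apply f u\<bar>)" for f :: "'a \<Rightarrow>\<^sub>L real"
  have zB: "0 \<in> ?B" using subspace_0[OF subspace_closure_vector_hull] by simp
  then have ne: "?B \<noteq> {}" by blast
  have fB: "\<bar>blinfun_apply f u\<bar> \<le> norm f" if "u \<in> ?B" for f u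
  proof -
    have "norm f * norm u \<le> norm f * 1" using that by (intro mult_left_mono) auto
    then show ?thesis using norm_blinfun[of f u] by simp
  qed
  have bdd: "bdd_above ((\<lambda>u. \<bar>blinfun_apply f u\<bar>) ` ?B)" for f :: "'a \<Rightarrow>\<^sub>L real"
    by (rule bdd_aboveI2[OF fB])
  have s_upper: "\<bar>blinfun_apply f u\<bar> \<le> s f" if "u \<in> ?B" for f u
    unfolding s_def by (rule cSUP_upper[OF that bdd])
  have s_least: "s f \<le> c" if "\<And>u. u \<in> ?B \<Longrightarrow> \<bar>blinfun_apply f u\<bar> \<le> c" for f c
    unfolding s_def using that ne by (intro cSUP_least) auto
  have s_norm: "s f \<le> norm f" for f by (intro s_least fB)
  have s_nonneg: "0 \<le> s f" for f using s_upper[OF zB, of f] by simp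
  have s_add: "s (f + g) \<le> s f + s g" for f g
    by (rule s_least)
      (use s_upper in \<open>auto simp: blinfun.add_left intro: order_trans[OF abs_triangle_ineq] add_mono\<close>)
  have s_le: "s (t *\<^sub>R f) \<le> \<bar>t\<bar> * s f" for t f
    by (rule s_least) (use s_upper in \<open>auto simp: blinfun.scaleR_left abs_mult intro: mult_left_mono\<close>)
  have s_scale: "s (t *\<^sub>R f) = \<bar>t\<bar> * s f" for t f
  proof (cases "t = 0")
    case True
    then show ?thesis using s_le[of t f] s_nonneg[of "t *\<^sub>R f"] by simp
  next
    case False
    have "s f \<le> \<bar>1/t\<bar> * s (t *\<^sub>R f)" using s_le[of "1/t" "t *\<^sub>R f"] False by simp
    then have "\<bar>t\<bar> * s f \<le> s (t *\<^sub>R f)" using False by (simp add: field_simps)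
    with s_le show ?thesis by (simp add: order_antisym)
  qed
  have dom: "\<bar>blinfun_apply f y\<bar> \<le> norm y * s f" if f: "f \<in> ?V" for f
  proof (rule field_le_epsilon)
    fix e :: real assume e: "e > 0"
    \<comment> \<open>Three errors of size \<open>d * norm y\<close> occur: replacing
      \<open>s g\<close> by \<open>s f\<close>, the slack of the witness for \<open>g\<close>, and
      replacing \<open>g\<close> by \<open>f\<close> at \<open>y\<close>. The summand 1 avoids
      division by zero.\<close>
    define d where "d = e / (3 * (norm y + 1))"
    have d: "d > 0" "3 * d * norm y \<le> e"
      using e by (auto simp: d_def field_simps add_pos_nonneg)
    obtain g where g: "g \<in> functional_hull Y Z" "dist g f < d"
      using f d(1) unfolding closure_approachable by blast
    obtain k where k: "1 / real (Suc k) < d"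
      using d(1) nat_approx_posE by blast
    let ?w = "norming_vector Y k g"
    have "?w \<in> ?B"
      \<comment> \<open>The witness is almost norming for \<open>g\<close> on all of
        \<open>Y\<close> and yet belongs to the vector hull, so \<open>s g\<close> controls
        \<open>g\<close> at \<open>y\<close>.\<close>
      using norming_vector_in_hull[OF g(1)] closure_subset norming_vector[OF Y] by blast
    then have "\<bar>blinfun_apply g ?w\<bar> \<le> s g" by (rule s_upper)
    moreover have "s g \<le> s f + norm (g - f)" using s_add[of f "g - f"] s_norm[of "g - f"] by simp
    ultimately have "\<bar>blinfun_apply g ?w\<bar> + 1 / real (Suc k) \<le> s f + 2 * d"
      using g(2) k by (simp add: dist_norm)
    then have "\<bar>blinfun_apply g y\<bar> \<le> (s f + 2 * d) * norm y"
      using norming_vector(3)[OF Y y, of g k] mult_right_mono[of _ "s f + 2 * d" "norm y"]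
      by (meson norm_ge_zero order_trans)
    moreover have "\<bar>blinfun_apply (f - g) y\<bar> \<le> d * norm y"
      using norm_blinfun[of "f - g" y] mult_right_mono[of "norm (f - g)" d "norm y"] g(2)
      by (simp add: dist_norm norm_minus_commute)
    ultimately have "\<bar>blinfun_apply f y\<bar> \<le> norm y * s f + 3 * d * norm y"
      by (simp add: blinfun.diff_left algebra_simps)
    then show "\<bar>blinfun_apply f y\<bar> \<le> norm y * s f + e" using d(2) by linarith
  qed
  let ?G = "(\<lambda>f. (f, blinfun_apply f y)) ` ?V"
  have "linear (\<lambda>f. (f, blinfun_apply f y))"
    by (rule linearI) (auto simp: blinfun.add_left blinfun.scaleR_left)
  then have G: "subspace ?G" by (rule linear_subspace_image[OF _ subspace_closure_functional_hull])
  have bound: "norm y * s f \<le> norm y * norm f" for f by (intro mult_left_mono s_norm) simp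
  have add: "norm y * s (f + g) \<le> norm y * s f + norm y * s g" for f g
    using mult_left_mono[OF s_add[of f g], of "norm y"] by (simp add: algebra_simps)
  have scale: "norm y * s (t *\<^sub>R f) = \<bar>t\<bar> * (norm y * s f)" for t f by (simp add: s_scale)
  have dom': "a \<le> norm y * s f" if "(f, a) \<in> ?G" for f a
    using that dom by (fastforce intro: order_trans[OF abs_ge_self])
  obtain \<Phi> :: "('a \<Rightarrow>\<^sub>L real) \<Rightarrow>\<^sub>L real"
    where \<Phi>: "\<And>f. \<bar>blinfun_apply \<Phi> f\<bar> \<le> norm y * s f"
      "\<And>f a. (f, a) \<in> ?G \<Longrightarrow> blinfun_apply \<Phi> f = a"
    using hahn_banach_blinfun[of "\<lambda>f. norm y * s f", OF add scale bound G dom'] by blast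
  obtain x where x: "\<Phi> = canonical_embedding x"
    using refl unfolding reflexive_space_def by (metis surjD)
  have xf: "\<bar>blinfun_apply f x\<bar> \<le> norm y * s f" for f using \<Phi>(1)[of f] x by simp
  have "x \<in> ?U"
  proof (rule ccontr)
    assume "x \<notin> ?U"
    then obtain f :: "'a \<Rightarrow>\<^sub>L real"
      where f: "\<And>a. a \<in> ?U \<Longrightarrow> blinfun_apply f a = 0" "blinfun_apply f x \<noteq> 0"
      using subspace_separating_functional[OF subspace_closure_vector_hull, of x Y Z]
      by (metis closure_closure)
    have "s f \<le> 0" by (rule s_least) (use f(1) in auto)
    then show False using xf[of f] s_nonneg[of f] f(2) by simp
  qed
  moreover have "norm x \<le> norm y"
  proof -
    let ?f = "norming_functional x"
    have "norm x \<le> norm y * s ?f" using xf[of ?f] norming_functional(2)[of x] by simp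
    also have "\<dots> \<le> norm y * 1"
      using s_norm[of ?f] norming_functional(1)[of x] by (intro mult_left_mono) auto
    finally show ?thesis by simp
  qed
  moreover have "blinfun_apply f x = blinfun_apply f y" if "f \<in> functional_hull Y Z" for f
    using \<Phi>(2)[of f "blinfun_apply f y"] that closure_subset x by fastforce
  ultimately show ?thesis by blast
qed

section \<open>Linearity, composition and continuity of the hull projections\<close>

definition hull_projection :: "'a::real_normed_vector set \<Rightarrow> 'a set \<Rightarrow> 'a \<Rightarrow> 'a" where
  "hull_projection Y Z y = (SOME x. x \<in> closure (vector_hull Y Z) \<and> norm x \<le> norm y \<and>
    (\<forall>f\<in>functional_hull Y Z. blinfun_apply f x = blinfun_apply f y))"

locale closed_subspace_of_reflexive =
  fixes Y :: "'a::real_normed_vector set"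
  assumes refl: "reflexive_space TYPE('a)" and Y: "subspace Y" "closed Y"
begin

abbreviation "U Z \<equiv> closure (vector_hull Y Z)"
abbreviation "P \<equiv> hull_projection Y"

lemma U_subset: "Z \<subseteq> Y \<Longrightarrow> U Z \<subseteq> Y"
  by (intro closure_minimal vector_hull_subset Y)

lemma U_mono: "Z \<subseteq> Z' \<Longrightarrow> U Z \<subseteq> U Z'"
  by (intro closure_mono vector_hull_mono)

lemma projection:
  assumes "y \<in> Y"
  shows projection_in: "P Z y \<in> U Z" and norm_projection_le: "norm (P Z y) \<le> norm y"
    and projection_apply: "f \<in> functional_hull Y Z \<Longrightarrow> blinfun_apply f (P Z y) = blinfun_apply f y"
proof -
  have "P Z y \<in> U Z \<and> norm (P Z y) \<le> norm y \<and>
      (\<forall>f\<in>functional_hull Y Z. blinfun_apply f (P Z y) = blinfun_apply f y)"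
    unfolding hull_projection_def
    by (rule someI_ex) (use ex_projection[OF refl Y(1) assms, of Z] in blast)
  then show "P Z y \<in> U Z" "norm (P Z y) \<le> norm y"
    "f \<in> functional_hull Y Z \<Longrightarrow> blinfun_apply f (P Z y) = blinfun_apply f y" by auto
qed

text \<open>Since the functional hull separates the points of \<open>U Z\<close>, its values at
  \<open>y\<close> determine the projection. Linearity and composition then reduce to comparing
  values of functionals.\<close>

lemma projection_eqI:
  assumes y: "y \<in> Y" and x: "x \<in> U Z"
    and eq: "\<And>f. f \<in> functional_hull Y Z \<Longrightarrow> blinfun_apply f x = blinfun_apply f y"
  shows "P Z y = x"
proof -
  have "P Z y - x \<in> U Z"
    using projection_in[OF y] x by (intro subspace_diff subspace_closure_vector_hull)
  then have "P Z y - x = 0"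
    by (rule functional_hull_separates) (simp add: blinfun.diff_right eq projection_apply[OF y])
  then show ?thesis by simp
qed

lemma projection_id: "Z \<subseteq> Y \<Longrightarrow> x \<in> U Z \<Longrightarrow> P Z x = x"
  using U_subset by (intro projection_eqI) auto

lemma projection_in_Y: "Z \<subseteq> Y \<Longrightarrow> y \<in> Y \<Longrightarrow> P Z y \<in> Y"
  using projection_in U_subset by blast

lemma projection_add:
  assumes "x \<in> Y" "y \<in> Y" shows "P Z (x + y) = P Z x + P Z y"
  using assms
  by (intro projection_eqI)
    (auto simp: blinfun.add_right projection_apply intro: subspace_add Y(1)
      subspace_closure_vector_hull projection_in)

lemma projection_scaleR:
  assumes "x \<in> Y" shows "P Z (c *\<^sub>R x) = c *\<^sub>R P Z x"
  using assms
  by (intro projection_eqI)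
    (auto simp: blinfun.scaleR_right projection_apply intro: subspace_scale Y(1)
      subspace_closure_vector_hull projection_in)

lemma projection_diff:
  assumes "x \<in> Y" "y \<in> Y" shows "P Z (x - y) = P Z x - P Z y"
  using assms
  by (intro projection_eqI)
    (auto simp: blinfun.diff_right projection_apply intro: subspace_diff Y(1)
      subspace_closure_vector_hull projection_in)

text \<open>The functional hull grows with the generators, so \<open>P Z'\<close> preserves the
  values at \<open>y\<close> of all functionals that determine \<open>P Z y\<close>.\<close>

lemma projection_projection:
  assumes "Z \<subseteq> Z'" "Z' \<subseteq> Y" "y \<in> Y"
  shows "P Z (P Z' y) = P Z y"
  using assms functional_hull_mono[OF assms(1), of Y]
  by (intro projection_eqI) (auto simp: projection_apply intro: projection_in projection_in_Y)

text \<open>The projections converge along a chain: the limit point is approximated by some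
  \<open>u\<close> in the hull of a single member \<open>C\<close>, every \<open>P Z\<close> with
  \<open>Z\<close> above \<open>C\<close> fixes \<open>u\<close>, and contractivity bounds the error
  by twice the distance to \<open>u\<close>.\<close>

lemma projection_Union_chain:
  assumes \<C>: "subset.chain UNIV \<C>" "\<C> \<noteq> {}" and sub: "\<Union>\<C> \<subseteq> Y" and y: "y \<in> Y" and e: "e > 0"
  obtains C where "C \<in> \<C>"
    "\<And>Z. C \<subseteq> Z \<Longrightarrow> Z \<subseteq> \<Union>\<C> \<Longrightarrow> norm (P Z y - P (\<Union>\<C>) y) < e"
proof -
  let ?x = "P (\<Union>\<C>) y"
  obtain u where u: "u \<in> vector_hull Y (\<Union>\<C>)" "dist u ?x < e / 2"
    using projection_in[OF y, of "\<Union>\<C>"] e unfolding closure_approachable by (meson half_gt_zero)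
  obtain C where C: "C \<in> \<C>" "u \<in> vector_hull Y C"
    using vector_hull_Union_chain[OF \<C> u(1)] by blast
  have uY: "u \<in> Y" using u(1) vector_hull_subset[OF Y(1) sub] by blast
  have xY: "?x \<in> Y" using projection_in_Y[OF sub y] .
  have "norm (P Z y - ?x) < e" if Z: "C \<subseteq> Z" "Z \<subseteq> \<Union>\<C>" for Z
  proof -
    have "u \<in> U Z" using C(2) vector_hull_mono[OF Z(1)] closure_subset by blast
    then have "P Z u = u" using Z sub by (intro projection_id) auto
    moreover have "P Z ?x = P Z y" using projection_projection[OF Z(2) sub y] .
    ultimately have "P Z y - ?x = P Z (?x - u) - (?x - u)"
      using projection_diff[OF xY uY, of Z] by simp
    also have "norm \<dots> \<le> norm (P Z (?x - u)) + norm (?x - u)" by (rule norm_triangle_ineq4)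
    also have "\<dots> \<le> norm (?x - u) + norm (?x - u)"
      using norm_projection_le subspace_diff[OF Y(1) xY uY] by auto
    finally show ?thesis using u(2) by (simp add: dist_norm norm_minus_commute)
  qed
  then show ?thesis using that C(1) by blast
qed

end

section \<open>Increments of the projections along a well-order\<close>

context closed_subspace_of_reflexive
begin

text \<open>The long sequence of projections is indexed by a well-order on the generators themselves.\<close>

definition increment :: "'a rel \<Rightarrow> 'a \<Rightarrow> 'a \<Rightarrow> 'a" where
  "increment r a y = P (under r a) y - P (underS r a) y"

lemma increment_in: "y \<in> Y \<Longrightarrow> increment r a y \<in> U (under r a)"
  unfolding increment_def
  using projection_in U_mono[OF underS_subset_under]
  by (intro subspace_diff subspace_closure_vector_hull) blast+

lemma increment_add: "x \<in> Y \<Longrightarrow> y \<in> Y \<Longrightarrow> increment r a (x + y) = increment r a x + increment r a y"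
  by (simp add: increment_def projection_add)

lemma increment_scaleR: "x \<in> Y \<Longrightarrow> increment r a (c *\<^sub>R x) = c *\<^sub>R increment r a x"
  by (simp add: increment_def projection_scaleR scaleR_diff_right)

lemma norm_increment_le: "y \<in> Y \<Longrightarrow> norm (increment r a y) \<le> 2 * norm y"
  unfolding increment_def
  using norm_projection_le[of y "under r a"] norm_projection_le[of y "underS r a"]
    norm_triangle_ineq4[of "P (under r a) y" "P (underS r a) y"] by linarith

lemma under_subset_Field: "under r a \<subseteq> Field r"
  by (auto simp: under_def Field_def)

context
  fixes r :: "'a rel"
  assumes r: "Well_order r" and field: "Field r \<subseteq> Y"
begin

lemma
  shows r_refl: "a \<in> Field r \<Longrightarrow> (a, a) \<in> r"
    and r_trans: "trans r" and r_antisym: "antisym r"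
    and r_total: "a \<in> Field r \<Longrightarrow> b \<in> Field r \<Longrightarrow> (a, b) \<in> r \<or> (b, a) \<in> r"
    and r_wf: "wf (r - Id)"
proof -
  have "refl_on (Field r) r" and tot: "total_on (Field r) r" and "trans r" "antisym r" "wf (r - Id)"
    using r by (auto simp: order_on_defs)
  then show refl: "\<And>a. a \<in> Field r \<Longrightarrow> (a, a) \<in> r" and "trans r" "antisym r" "wf (r - Id)"
    by (auto dest: refl_onD)
  show "a \<in> Field r \<Longrightarrow> b \<in> Field r \<Longrightarrow> (a, b) \<in> r \<or> (b, a) \<in> r"
    using tot refl by (cases "a = b") (auto simp: total_on_def)
qed

lemma chain_under: "I \<subseteq> Field r \<Longrightarrow> subset.chain UNIV (under r ` I)"
proof -
  assume I: "I \<subseteq> Field r"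
  have "under r a \<subseteq> under r b \<or> under r b \<subseteq> under r a" if "a \<in> I" "b \<in> I" for a b
    using r_total[of a b] under_incr[OF r_trans] that I by blast
  then show ?thesis by (auto simp: subset_chain_def)
qed

text \<open>This is the limit step of the transfinite induction: a nonempty \<open>I\<close> is the
  union of the chain of segments \<open>under r a\<close>, and projections are continuous along
  chains.\<close>

lemma projection_eq_0_of_under:
  assumes I: "I \<subseteq> Field r" and down: "\<And>a. a \<in> I \<Longrightarrow> under r a \<subseteq> I"
    and zero: "\<And>a. a \<in> I \<Longrightarrow> P (under r a) y = 0" and y: "y \<in> Y"
  shows "P I y = 0"
proof (cases "I = {}")
  case True
  then show ?thesis using projection_in[OF y, of I] by (simp add: vector_hull_empty)
next
  case False
  have UI: "\<Union>(under r ` I) = I" using down r_refl I by (fastforce simp: under_def)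
  have ne: "under r ` I \<noteq> {}" using False by simp
  have sub: "\<Union>(under r ` I) \<subseteq> Y" using UI I field by simp
  have "norm (P I y) \<le> 0 + e" if e: "e > 0" for e
  proof -
    obtain C where C: "C \<in> under r ` I"
      "\<And>Z. C \<subseteq> Z \<Longrightarrow> Z \<subseteq> \<Union>(under r ` I) \<Longrightarrow> norm (P Z y - P (\<Union>(under r ` I)) y) < e"
      using projection_Union_chain[OF chain_under[OF I] ne sub y e] by blast
    have "norm (P C y - P I y) < e" using C(2)[of C] C(1) unfolding UI using UI by blast
    then show ?thesis using C(1) zero by auto
  qed
  then have "norm (P I y) \<le> 0" by (rule field_le_epsilon)
  then show ?thesis by simp
qed

text \<open>By well-founded induction all \<open>P (under r a) y\<close> vanish: the limit step
  gives \<open>P (underS r a) y = 0\<close>, and the zero increment passes this on to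
  \<open>under r a\<close>. Finally \<open>P (Field r)\<close> fixes \<open>y\<close>.\<close>

lemma increments_separate:
  assumes y: "y \<in> U (Field r)" and zero: "\<And>a. a \<in> Field r \<Longrightarrow> increment r a y = 0"
  shows "y = 0"
proof -
  have yY: "y \<in> Y" using y U_subset[OF field] by blast
  have *: "P (under r a) y = 0" if "a \<in> Field r" for a
    using r_wf that
  proof (induction a rule: wf_induct_rule)
    case (less a)
    have "P (underS r a) y = 0"
    proof (rule projection_eq_0_of_under[OF _ _ _ yY])
      show "underS r a \<subseteq> Field r" by (auto simp: underS_def Field_def)
      show "under r b \<subseteq> underS r a" if "b \<in> underS r a" for b
        using that r_trans r_antisym unfolding underS_def under_def trans_def antisym_def by blast
      show "P (under r b) y = 0" if "b \<in> underS r a" for b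
        using that less.IH[of b] by (auto simp: underS_def Field_def)
    qed
    then show "P (under r a) y = 0" using zero[OF less.prems] by (simp add: increment_def)
  qed
  have "P (Field r) y = 0"
    by (rule projection_eq_0_of_under[OF order_refl under_subset_Field * yY])
  then show ?thesis using projection_id[OF field y] by simp
qed

text \<open>Infinitely many large increments would contradict the convergence of the projections
  along an increasing sequence of initial segments.\<close>

lemma finite_large_increments:
  assumes y: "y \<in> Y" and e: "e > 0"
  shows "finite {a \<in> Field r. e < norm (increment r a y)}" (is "finite ?J")
proof (rule ccontr)
  assume inf: "infinite ?J"
  \<comment> \<open>The elements of \<open>?J\<close> with finitely many predecessors in
    \<open>?J\<close>. Were \<open>K\<close> finite, the least element of \<open>?J\<close> outside
    it would have all its predecessors in \<open>K\<close> and so belong to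
    \<open>K\<close>.\<close>
  define K where "K = {a \<in> ?J. finite (?J \<inter> underS r a)}"
  have KF: "K \<subseteq> Field r" by (auto simp: K_def)
  have Kinf: "infinite K"
  proof
    assume fin: "finite K"
    have "K \<subseteq> ?J" by (auto simp: K_def)
    then have "?J - K \<noteq> {}" using fin inf by (auto dest: finite_subset)
    then obtain k where "k \<in> ?J - K" by blast
    then obtain m where m: "m \<in> ?J - K" "\<And>b. (b, m) \<in> r - Id \<Longrightarrow> b \<notin> ?J - K"
      by (rule wfE_min[OF r_wf]) blast
    have "?J \<inter> underS r m \<subseteq> K" using m(2) by (auto simp: underS_def)
    then have "m \<in> K" using m(1) fin unfolding K_def by (auto intro: finite_subset)
    then show False using m(1) by blast
  qed
  then have ne: "under r ` K \<noteq> {}" by auto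
  have sub: "\<Union>(under r ` K) \<subseteq> Y" using under_subset_Field field by fastforce
  obtain C where C: "C \<in> under r ` K"
    "\<And>Z. C \<subseteq> Z \<Longrightarrow> Z \<subseteq> \<Union>(under r ` K) \<Longrightarrow> norm (P Z y - P (\<Union>(under r ` K)) y) < e / 2"
    using projection_Union_chain[OF chain_under[OF KF] ne sub y half_gt_zero[OF e]] by blast
  then obtain a where a: "a \<in> K" "C = under r a" by blast
  \<comment> \<open>An element \<open>b\<close> of \<open>K\<close> beyond \<open>a\<close> would
    have both \<open>under r b\<close> and \<open>underS r b\<close> above \<open>C\<close>, so both
    projections would be within \<open>e / 2\<close> of the limit and the increment at
    \<open>b\<close> below \<open>e\<close>.\<close>
  have "K \<subseteq> insert a (?J \<inter> underS r a)"
  proof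
    fix b assume b: "b \<in> K"
    show "b \<in> insert a (?J \<inter> underS r a)"
    proof (rule ccontr)
      assume nb: "b \<notin> insert a (?J \<inter> underS r a)"
      then have ab: "(a, b) \<in> r" "a \<noteq> b" using r_total[of a b] a(1) b KF
        by (auto simp: underS_def K_def)
      have "under r a \<subseteq> underS r b"
        using ab r_trans r_antisym unfolding underS_def under_def trans_def antisym_def by blast
      moreover have "underS r b \<subseteq> under r b" by (rule underS_subset_under)
      moreover have "under r b \<subseteq> \<Union>(under r ` K)" using b by blast
      ultimately have "norm (P (under r b) y - P (\<Union>(under r ` K)) y) < e / 2"
        "norm (P (underS r b) y - P (\<Union>(under r ` K)) y) < e / 2"
        using a(2) C(2) order_trans by metis+
      then have "norm (increment r b y) < e"
        using norm_triangle_ineq4[of "P (under r b) y - P (\<Union>(under r ` K)) y"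
          "P (underS r b) y - P (\<Union>(under r ` K)) y"] by (simp add: increment_def)
      then show False using b by (auto simp: K_def)
    qed
  qed
  moreover have "finite (?J \<inter> underS r a)" using a(1) by (simp add: K_def)
  ultimately show False using Kinf by (meson finite_insert finite_subset)
qed

end

end

section \<open>Injections of reflexive spaces into c0\<close>

unbundle cardinal_syntax

text \<open>Terms are stratified by size; each layer arises from the previous one by finitely many
  constructors with countable parameters. The separate bound \<open>R\<close> lets a finite
  \<open>Z\<close> be compared with the naturals.\<close>

lemma card_skolem_terms:
  fixes Z :: "'a set" and R :: "'b set"
  assumes inf: "infinite R" and Z: "|Z| \<le>o |R|"
  shows "|{t. set_skolem_term t \<subseteq> Z}| \<le>o |R|"
proof -
  have R: "Cinfinite |R|" using inf by (simp add: cinfinite_def Field_card_of card_of_card_order_on)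
  have image: "|h ` A| \<le>o |R|" if "|A| \<le>o |R|" for h :: "'c \<Rightarrow> 'd" and A
    using ordLeq_transitive[OF card_of_image that] .
  have times: "|A \<times> B| \<le>o |R|" if "|A| \<le>o |R|" "|B| \<le>o |R|" for A :: "'c set" and B :: "'d set"
    using that inf by (intro card_of_Times_ordLeq_infinite_Field)
      (auto simp: Field_card_of card_of_card_order_on)
  have nat: "|UNIV :: nat set| \<le>o |R|" using inf by (simp add: infinite_iff_card_of_nat[symmetric])
  have rat: "|UNIV :: rat set| \<le>o |R|"
  proof -
    have "|UNIV :: rat set| \<le>o |UNIV :: nat set|"
      by (rule card_of_ordLeq[THEN iffD1]) (use inj_to_nat in auto)
    then show ?thesis using nat ordLeq_transitive by blast
  qed
  define T where "T n = {t. set_skolem_term t \<subseteq> Z \<and> size t \<le> n}" for n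
  let ?B = "{Null} \<union> Gen ` Z"
  have B: "|?B| \<le>o |R|"
    using infinite_imp_nonempty[OF inf] by (intro Un_Cinfinite_bound image R Z card_of_singl_ordLeq)
  have "|T n| \<le>o |R|" for n
  proof (induction n)
    case 0
    have "t \<in> ?B" if "t \<in> T 0" for t using that by (cases t) (auto simp: T_def)
    then have "T 0 \<subseteq> ?B" by blast
    then show ?case using B card_of_mono1 ordLeq_transitive by blast
  next
    case (Suc n)
    let ?T = "?B \<union> (\<lambda>(s, t). Add s t) ` (T n \<times> T n) \<union> (\<lambda>(q, t). Scale q t) ` (UNIV \<times> T n) \<union>
      Functional ` T n \<union> (\<lambda>(k, t). Witness k t) ` (UNIV \<times> T n)"
    have "t \<in> ?T" if "t \<in> T (Suc n)" for t using that by (cases t) (auto simp: T_def)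
    then have "T (Suc n) \<subseteq> ?T" by blast
    moreover have "|?T| \<le>o |R|" by (intro Un_Cinfinite_bound[OF _ _ R] B image times Suc nat rat)
    ultimately show ?case using card_of_mono1 ordLeq_transitive by blast
  qed
  then have "|\<Union>n. T n| \<le>o |R|" using inf nat by (intro card_of_UNION_ordLeq_infinite) auto
  moreover have "{t. set_skolem_term t \<subseteq> Z} = (\<Union>n. T n)" by (auto simp: T_def)
  ultimately show ?thesis by simp
qed

lemma card_hulls:
  fixes R :: "'b set"
  assumes "infinite R" and "|Z| \<le>o |R|"
  shows card_vector_hull: "|vector_hull Y Z| \<le>o |R|"
    and card_functional_hull: "|functional_hull Y Z| \<le>o |R|"
proof -
  have "vector_hull Y Z = (fst \<circ> skolem_eval Y) ` {t. set_skolem_term t \<subseteq> Z}"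
    "functional_hull Y Z = (snd \<circ> skolem_eval Y) ` {t. set_skolem_term t \<subseteq> Z}"
    by (auto simp: vector_hull_def functional_hull_def)
  then show "|vector_hull Y Z| \<le>o |R|" "|functional_hull Y Z| \<le>o |R|"
    using ordLeq_transitive[OF card_of_image card_skolem_terms[OF assms]] by metis+
qed

text \<open>The maps in \<open>F\<close> are the coordinates of an injection of \<open>Y\<close> into \<open>c0\<close>; they need not be
  linear off \<open>Y\<close>.\<close>

definition c0_separating :: "'a::real_normed_vector set \<Rightarrow> ('a \<Rightarrow> real) set \<Rightarrow> bool" where
  "c0_separating Y F \<longleftrightarrow>
     (\<forall>f\<in>F. (\<forall>x\<in>Y. \<forall>y\<in>Y. f (x + y) = f x + f y) \<and> (\<forall>c. \<forall>x\<in>Y. f (c *\<^sub>R x) = c * f x) \<and>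
        (\<forall>x\<in>Y. \<bar>f x\<bar> \<le> norm x)) \<and>
     (\<forall>x\<in>Y. (\<forall>f\<in>F. f x = 0) \<longrightarrow> x = 0) \<and>
     (\<forall>x\<in>Y. \<forall>e>0. finite {f \<in> F. e < \<bar>f x\<bar>})"

lemma c0_separatingD:
  assumes "c0_separating Y F"
  shows "f \<in> F \<Longrightarrow> x \<in> Y \<Longrightarrow> y \<in> Y \<Longrightarrow> f (x + y) = f x + f y"
    and "f \<in> F \<Longrightarrow> x \<in> Y \<Longrightarrow> f (c *\<^sub>R x) = c * f x"
    and "f \<in> F \<Longrightarrow> x \<in> Y \<Longrightarrow> \<bar>f x\<bar> \<le> norm x"
    and "x \<in> Y \<Longrightarrow> (\<And>f. f \<in> F \<Longrightarrow> f x = 0) \<Longrightarrow> x = 0"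
    and "x \<in> Y \<Longrightarrow> e > 0 \<Longrightarrow> finite {f \<in> F. e < \<bar>f x\<bar>}"
  using assms by (simp_all add: c0_separating_def)

lemma c0_separating_subset: "c0_separating Y F \<Longrightarrow> Y' \<subseteq> Y \<Longrightarrow> c0_separating Y' F"
  unfolding c0_separating_def by (meson subsetD)

lemma closure_span_subset_closure_vector_hull: "closure (span S) \<subseteq> closure (vector_hull Y S)"
  using generators_subset_vector_hull closure_subset
  by (intro closure_minimal closed_closure span_minimal subspace_closure_vector_hull) blast

text \<open>The functional hull of \<open>S\<close> is countable and separates the points of the
  closed span. Scaling its members to norm at most \<open>1 / real (Suc n)\<close> makes the
  coordinates of each vector tend to 0.\<close>

lemma c0_separating_countable:
  fixes S :: "'a::real_normed_vector set"
  assumes S: "|S| \<le>o |UNIV :: nat set|"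
  shows "\<exists>F. c0_separating (closure (span S)) F"
proof -
  let ?V = "functional_hull UNIV S"
  have "|?V| \<le>o |UNIV :: nat set|" by (intro card_functional_hull S) simp
  then have "countable ?V" unfolding countable_def card_of_ordLeq[symmetric] by auto
  moreover have "?V \<noteq> {}" using functional_hullI[of Null S UNIV] by auto
  ultimately obtain v :: "nat \<Rightarrow> 'a \<Rightarrow>\<^sub>L real" where v: "range v = ?V"
    by (metis range_from_nat_into)
  define g where "g n x = blinfun_apply (v n) x / ((1 + norm (v n)) * real (Suc n))" for n x
  have pos: "(1 + norm (v n)) * real (Suc n) > 0" for n by (intro mult_pos_pos add_pos_nonneg) auto
  have bound: "\<bar>g n x\<bar> \<le> norm x / real (Suc n)" for n x
  proof -
    have "\<bar>blinfun_apply (v n) x\<bar> \<le> norm (v n) * norm x" using norm_blinfun[of "v n" x] by simp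
    also have "\<dots> \<le> (1 + norm (v n)) * norm x" by (intro mult_right_mono) auto
    finally have "\<bar>blinfun_apply (v n) x\<bar> / ((1 + norm (v n)) * real (Suc n))
        \<le> (1 + norm (v n)) * norm x / ((1 + norm (v n)) * real (Suc n))"
      using pos[of n] by (intro divide_right_mono) auto
    also have "\<dots> = norm x / real (Suc n)"
      using add_pos_nonneg[of 1 "norm (v n)"] by (intro mult_divide_mult_cancel_left) auto
    finally show ?thesis using pos[of n] by (simp add: g_def abs_mult)
  qed
  have "x = 0" if "x \<in> closure (span S)" "\<forall>n. g n x = 0" for x
  proof (rule functional_hull_separates)
    show "x \<in> closure (vector_hull UNIV S)"
      using that(1) closure_span_subset_closure_vector_hull by blast
    fix f assume "f \<in> ?V"
    then obtain n where "f = v n" using v by blast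
    then show "blinfun_apply f x = 0" using that(2) pos[of n] by (auto simp: g_def)
  qed
  moreover have "finite {f \<in> range g. e < \<bar>f x\<bar>}" if e: "e > 0" for e x
  proof -
    have "{f \<in> range g. e < \<bar>f x\<bar>} \<subseteq> g ` {n. n \<le> nat \<lceil>norm x / e\<rceil>}"
    proof
      fix f assume "f \<in> {f \<in> range g. e < \<bar>f x\<bar>}"
      then obtain n where n: "f = g n" "e < \<bar>g n x\<bar>" by blast
      then have "e < norm x / real (Suc n)" using bound[of n x] by linarith
      then have "real (Suc n) < norm x / e" using e by (simp add: field_simps)
      then have "n \<le> nat \<lceil>norm x / e\<rceil>" by linarith
      then show "f \<in> g ` {n. n \<le> nat \<lceil>norm x / e\<rceil>}" using n(1) by blast
    qed
    then show ?thesis by (rule finite_subset) simp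
  qed
  moreover have "\<bar>g n x\<bar> \<le> norm x" for n x
  proof -
    have "norm x / real (Suc n) \<le> norm x / 1" by (intro divide_left_mono) auto
    then show ?thesis using bound[of n x] by simp
  qed
  ultimately have "c0_separating (closure (span S)) (range g)"
    unfolding c0_separating_def
    by (auto simp: g_def blinfun.add_right blinfun.scaleR_right add_divide_distrib)
  then show ?thesis by blast
qed

text \<open>Coordinates for the closed hull of each initial segment are composed with the
  corresponding increment. Increments separate points, and only finitely many of them are large at a
  given vector.\<close>

lemma c0_separating_uncountable:
  fixes S :: "'a::real_normed_vector set"
  assumes refl: "reflexive_space TYPE('a)" and S: "|UNIV :: nat set| <o |S|"
    and IH: "\<And>S' :: 'a set. |S'| <o |S| \<Longrightarrow> \<exists>F. c0_separating (closure (span S')) F"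
  shows "\<exists>F. c0_separating (closure (span S)) F"
proof -
  let ?Y = "closure (span S)"
  have "subspace ?Y" by (rule subspace_closure_rational) (auto intro: span_zero span_add span_scale)
  then interpret closed_subspace_of_reflexive ?Y using refl by unfold_locales auto
  let ?r = "|S|"
  have r: "Well_order ?r" "Field ?r = S" by (auto simp: card_of_well_order_on Field_card_of)
  have SY: "S \<subseteq> ?Y" using span_superset closure_subset by blast
  \<comment> \<open>The hull of a finite segment is countable, hence smaller than the uncountable
    \<open>S\<close>; the hull of an infinite segment is no larger than the segment itself.\<close>
  have small: "|vector_hull ?Y (under ?r a)| <o |S|" if a: "a \<in> S" for a
  proof -
    have uS: "|underS ?r a| <o |S|" using card_of_underS[OF card_of_Card_order] a r(2) by metis
    have ins: "under ?r a \<subseteq> {a} \<union> underS ?r a" by (auto simp: under_def underS_def)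
    show ?thesis
    proof (cases "finite (underS ?r a)")
      case True
      then have "finite (under ?r a)" using ins finite_subset by blast
      then have "|under ?r a| \<le>o |UNIV :: nat set|"
        unfolding card_of_ordLeq[symmetric] using countable_finite by (auto simp: countable_def)
      then show ?thesis using card_vector_hull[OF infinite_UNIV_nat] S ordLeq_ordLess_trans by blast
    next
      case False
      have "|{a} \<union> underS ?r a| \<le>o |underS ?r a|"
        using False card_of_singl_ordLeq[OF infinite_imp_nonempty[OF False]]
        by (intro Un_Cinfinite_bound card_of_mono1[OF order_refl])
          (auto simp: cinfinite_def Field_card_of card_of_card_order_on)
      then have "|under ?r a| \<le>o |underS ?r a|" using ins card_of_mono1 ordLeq_transitive by blast
      then show ?thesis using card_vector_hull[OF False] uS ordLeq_ordLess_trans by blast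
    qed
  qed
  have "\<forall>a\<in>S. \<exists>F. c0_separating (U (under ?r a)) F"
  proof
    fix a assume "a \<in> S"
    \<comment> \<open>The hull itself is taken as the smaller generating set; its closed span
      contains \<open>U (under ?r a)\<close>.\<close>
    then obtain F where "c0_separating (closure (span (vector_hull ?Y (under ?r a)))) F"
      using IH[OF small] by blast
    then have "c0_separating (U (under ?r a)) F"
      by (rule c0_separating_subset) (intro closure_mono span_superset)
    then show "\<exists>F. c0_separating (U (under ?r a)) F" by blast
  qed
  then obtain E where E: "\<And>a. a \<in> S \<Longrightarrow> c0_separating (U (under ?r a)) (E a)" by metis
  let ?D = "increment ?r"
  \<comment> \<open>Halving compensates for the bound 2 on the increments.\<close>
  define h where "h a f y = f (?D a y) / 2" for a and f :: "'a \<Rightarrow> real" and y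
  let ?F = "\<Union>a\<in>S. h a ` E a"
  have lin: "h a f (x + y) = h a f x + h a f y" "h a f (c *\<^sub>R x) = c * h a f x" "\<bar>h a f x\<bar> \<le> norm x"
    if "a \<in> S" "f \<in> E a" "x \<in> ?Y" "y \<in> ?Y" for a f x y c
  proof -
    note f = c0_separatingD(1-3)[OF E[OF that(1)] that(2)]
    note D = increment_in[OF that(3), of ?r a] increment_in[OF that(4), of ?r a]
    show "h a f (x + y) = h a f x + h a f y"
      using f(1)[OF D] increment_add[OF that(3,4), of ?r a] by (simp add: h_def add_divide_distrib)
    show "h a f (c *\<^sub>R x) = c * h a f x"
      using f(2)[OF D(1)] increment_scaleR[OF that(3), of ?r a] by (simp add: h_def)
    show "\<bar>h a f x\<bar> \<le> norm x"
      using f(3)[OF D(1)] norm_increment_le[OF that(3), of ?r a] by (simp add: h_def)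
  qed
  have sep: "x = 0" if x: "x \<in> ?Y" and zero: "\<forall>g\<in>?F. g x = 0" for x
  proof (rule increments_separate[OF r(1)])
    show "Field ?r \<subseteq> ?Y" using SY r(2) by simp
    show "x \<in> U (Field ?r)" using x closure_span_subset_closure_vector_hull r(2) by auto
    fix a assume "a \<in> Field ?r"
    then have a: "a \<in> S" using r(2) by simp
    have "\<forall>f\<in>E a. f (?D a x) = 0" using zero a by (fastforce simp: h_def)
    then show "?D a x = 0" using c0_separatingD(4)[OF E[OF a] increment_in[OF x]] by blast
  qed
  have fin: "finite {g \<in> ?F. e < \<bar>g x\<bar>}" if x: "x \<in> ?Y" and e: "e > 0" for x e
  proof -
    let ?J = "{a \<in> Field ?r. e < norm (?D a x)}"
    let ?G = "\<Union>a\<in>?J. h a ` {f \<in> E a. e < \<bar>f (?D a x)\<bar>}"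
    have "{g \<in> ?F. e < \<bar>g x\<bar>} \<subseteq> ?G"
    proof
      fix g assume "g \<in> {g \<in> ?F. e < \<bar>g x\<bar>}"
      then obtain a f where g: "a \<in> S" "f \<in> E a" "g = h a f" "e < \<bar>g x\<bar>" by blast
      then have 1: "e < \<bar>f (?D a x)\<bar>" using e by (simp add: h_def)
      moreover have "\<bar>f (?D a x)\<bar> \<le> norm (?D a x)"
        by (rule c0_separatingD(3)[OF E[OF g(1)] g(2) increment_in[OF x]])
      ultimately have "a \<in> ?J" using g(1) r(2) by simp
      then show "g \<in> ?G" using g(2,3) 1 by blast
    qed
    moreover have "finite ?G"
    proof (intro finite_UN_I finite_imageI)
      show "finite ?J" using finite_large_increments[OF r(1) _ x e] SY r(2) by simp
      fix a assume "a \<in> ?J"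
      then have "a \<in> S" using r(2) by simp
      then show "finite {f \<in> E a. e < \<bar>f (?D a x)\<bar>}"
        using c0_separatingD(5)[OF E increment_in[OF x] e] by blast
    qed
    ultimately show ?thesis by (rule finite_subset)
  qed
  have "c0_separating ?Y ?F"
    unfolding c0_separating_def
  proof (intro conjI ballI allI impI)
    fix g x y and c :: real assume g: "g \<in> ?F" and x: "x \<in> ?Y"
    then obtain a f where af: "a \<in> S" "f \<in> E a" "g = h a f" by blast
    show "g (x + y) = g x + g y" if "y \<in> ?Y" using lin(1)[OF af(1,2) x that] af(3) by simp
    show "g (c *\<^sub>R x) = c * g x" "\<bar>g x\<bar> \<le> norm x" using lin(2,3)[OF af(1,2) x x] af(3) by simp_all
  qed (use sep fin in auto)
  then show ?thesis by blast
qed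

text \<open>Well-founded induction on the cardinality of a generating set, with the countable sets
  as base; the generating set \<open>UNIV\<close> gives the whole space.\<close>

lemma reflexive_imp_c0_separating:
  assumes "reflexive_space TYPE('a::real_normed_vector)"
  shows "\<exists>F. c0_separating (UNIV :: 'a set) F"
proof -
  have "\<exists>F. c0_separating (closure (span S)) F" for S :: "'a set"
  proof (rule wf_induct[OF wf_inv_image[OF wf_ordLess, of card_of], of _ S])
    fix S :: "'a set"
    assume "\<forall>S'. (S', S) \<in> inv_image ordLess card_of \<longrightarrow> (\<exists>F. c0_separating (closure (span S')) F)"
    then have IH: "\<And>S' :: 'a set. |S'| <o |S| \<Longrightarrow> \<exists>F. c0_separating (closure (span S')) F"
      unfolding in_inv_image by blast
    show "\<exists>F. c0_separating (closure (span S)) F"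
    proof (cases "|S| \<le>o |UNIV :: nat set|")
      case True
      then show ?thesis by (rule c0_separating_countable)
    next
      case False
      then have "|UNIV :: nat set| <o |S|"
        by (simp add: not_ordLeq_iff_ordLess card_of_Well_order)
      then show ?thesis using c0_separating_uncountable[OF assms _ IH] by blast
    qed
  qed
  from this[of UNIV] show ?thesis by simp
qed

section \<open>Square sums of seminorms\<close>

definition seminorm_sum :: "(nat \<Rightarrow> 'a \<Rightarrow> real) \<Rightarrow> 'a::real_normed_vector \<Rightarrow> real" where
  "seminorm_sum r x = sqrt (\<Sum>n. (r n x)\<^sup>2)"

text \<open>For a Hilbertian seminorm this is the square of \<open>r (x - y)\<close>, by the
  parallelogram law. In general a small value means near equality in the convexity estimate for the
  square of \<open>r\<close>.\<close>

definition parallelogram_defect :: "('a::ab_group_add \<Rightarrow> real) \<Rightarrow> 'a \<Rightarrow> 'a \<Rightarrow> real" where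
  "parallelogram_defect r x y = 2 * (r x)\<^sup>2 + 2 * (r y)\<^sup>2 - (r (x + y))\<^sup>2"

lemma parallelogram_defect_ge:
  fixes r :: "'a::real_normed_vector \<Rightarrow> real"
  assumes "r (x + y) \<le> r x + r y" "0 \<le> r (x + y)"
  shows "(r x - r y)\<^sup>2 \<le> parallelogram_defect r x y"
proof -
  have "(r (x + y))\<^sup>2 \<le> (r x + r y)\<^sup>2" using assms by (intro power_mono)
  then show ?thesis by (simp add: parallelogram_defect_def power2_eq_square algebra_simps)
qed

context
  fixes r :: "nat \<Rightarrow> 'a::real_normed_vector \<Rightarrow> real"
  assumes add: "\<And>n x y. r n (x + y) \<le> r n x + r n y"
    and hom: "\<And>n t x. r n (t *\<^sub>R x) = \<bar>t\<bar> * r n x"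
    and nonneg: "\<And>n x. 0 \<le> r n x"
    and bound: "\<And>n x. r n x \<le> (1 / 2) ^ n * norm x"
    and zero: "\<And>x. r 0 x = norm x"
begin

lemma seminorm_sum_square_le: "(r n x)\<^sup>2 \<le> (1 / 4) ^ n * (norm x)\<^sup>2"
proof -
  have "(r n x)\<^sup>2 \<le> ((1 / 2) ^ n * norm x)\<^sup>2" using bound nonneg by (intro power_mono)
  also have "\<dots> = ((1 / 2) * (1 / 2)) ^ n * (norm x)\<^sup>2"
    unfolding power_mult_distrib by (simp add: power2_eq_square)
  finally show ?thesis by simp
qed

lemma summable_seminorm_squares: "summable (\<lambda>n. (r n x)\<^sup>2)"
proof (rule summable_comparison_test')
  show "summable (\<lambda>n. (1 / 4) ^ n * (norm x)\<^sup>2)" by (intro summable_mult2 summable_geometric) simp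
  show "norm ((r n x)\<^sup>2) \<le> (1 / 4) ^ n * (norm x)\<^sup>2" if "n \<ge> 0" for n
    using seminorm_sum_square_le by simp
qed

lemma seminorm_sum_square: "(seminorm_sum r x)\<^sup>2 = (\<Sum>n. (r n x)\<^sup>2)"
  unfolding seminorm_sum_def by (intro real_sqrt_pow2 suminf_nonneg summable_seminorm_squares) simp

lemma seminorm_sum_nonneg: "0 \<le> seminorm_sum r x"
  unfolding seminorm_sum_def by (intro real_sqrt_ge_zero suminf_nonneg summable_seminorm_squares) simp

lemma L2_set_le_seminorm_sum: "L2_set (\<lambda>n. r n x) {..<N} \<le> seminorm_sum r x"
  unfolding L2_set_def seminorm_sum_def
  by (intro real_sqrt_le_mono sum_le_suminf summable_seminorm_squares) auto

text \<open>The triangle inequality is Minkowski's inequality for partial sums. The term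
  \<open>r 0\<close> gives the lower constant 1, and the geometric sum \<open>4 / 3\<close>, at most
  4, gives the upper constant 2.\<close>

lemma equivalent_norm_seminorm_sum: "equivalent_norm (seminorm_sum r)"
  unfolding equivalent_norm_def
proof (intro conjI allI exI)
  fix x y
  have "(\<lambda>N. \<Sum>n<N. (r n (x + y))\<^sup>2) \<longlonglongrightarrow> (\<Sum>n. (r n (x + y))\<^sup>2)"
    by (rule summable_LIMSEQ[OF summable_seminorm_squares])
  then have "(\<lambda>N. L2_set (\<lambda>n. r n (x + y)) {..<N}) \<longlonglongrightarrow> seminorm_sum r (x + y)"
    unfolding L2_set_def seminorm_sum_def by (rule tendsto_real_sqrt)
  then show "seminorm_sum r (x + y) \<le> seminorm_sum r x + seminorm_sum r y"
  proof (rule LIMSEQ_le_const2, intro exI allI impI)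
    fix N :: nat
    have "L2_set (\<lambda>n. r n (x + y)) {..<N} \<le> L2_set (\<lambda>n. r n x + r n y) {..<N}"
      using add nonneg by (intro L2_set_mono) auto
    also have "\<dots> \<le> L2_set (\<lambda>n. r n x) {..<N} + L2_set (\<lambda>n. r n y) {..<N}"
      by (rule L2_set_triangle_ineq)
    also have "\<dots> \<le> seminorm_sum r x + seminorm_sum r y" by (intro add_mono L2_set_le_seminorm_sum)
    finally show "L2_set (\<lambda>n. r n (x + y)) {..<N} \<le> seminorm_sum r x + seminorm_sum r y" .
  qed
next
  fix a x
  have "(\<Sum>n. (r n (a *\<^sub>R x))\<^sup>2) = a\<^sup>2 * (\<Sum>n. (r n x)\<^sup>2)"
    by (simp add: hom power_mult_distrib suminf_mult summable_seminorm_squares)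
  then show "seminorm_sum r (a *\<^sub>R x) = \<bar>a\<bar> * seminorm_sum r x"
    by (simp add: seminorm_sum_def real_sqrt_mult)
next
  fix x
  have "(r 0 x)\<^sup>2 \<le> (\<Sum>n. (r n x)\<^sup>2)"
    using sum_le_suminf[OF summable_seminorm_squares, of "{0}" x] by simp
  then show "1 * norm x \<le> seminorm_sum r x"
    unfolding seminorm_sum_def by (simp add: zero real_le_rsqrt)
  have "(\<Sum>n. (r n x)\<^sup>2) \<le> (\<Sum>n. (1 / 4) ^ n * (norm x)\<^sup>2)"
    by (intro suminf_le seminorm_sum_square_le summable_seminorm_squares summable_mult2 summable_geometric) simp
  also have "\<dots> = 4 / 3 * (norm x)\<^sup>2"
    by (subst suminf_mult2[symmetric]) (auto simp: suminf_geometric intro: summable_geometric)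
  also have "\<dots> \<le> (2 * norm x)\<^sup>2" by (simp add: power_mult_distrib)
  finally show "seminorm_sum r x \<le> 2 * norm x"
    unfolding seminorm_sum_def by (intro real_le_lsqrt) auto
qed auto

text \<open>The defect of the square sum is the sum of the defects, and each of these is
  nonnegative.\<close>

lemma parallelogram_defect_le_seminorm_sum:
  "parallelogram_defect (r n) x y \<le> parallelogram_defect (seminorm_sum r) x y"
proof -
  have s: "summable (\<lambda>n. 2 * (r n x)\<^sup>2 + 2 * (r n y)\<^sup>2)"
    by (intro summable_add summable_mult summable_seminorm_squares)
  have "parallelogram_defect (seminorm_sum r) x y
      = (\<Sum>n. 2 * (r n x)\<^sup>2 + 2 * (r n y)\<^sup>2) - (\<Sum>n. (r n (x + y))\<^sup>2)"
    by (simp add: parallelogram_defect_def seminorm_sum_square summable_seminorm_squares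
      summable_mult suminf_mult flip: suminf_add)
  also have "\<dots> = (\<Sum>n. parallelogram_defect (r n) x y)"
    unfolding parallelogram_defect_def by (intro suminf_diff s summable_seminorm_squares)
  finally have eq: "parallelogram_defect (seminorm_sum r) x y = (\<Sum>n. parallelogram_defect (r n) x y)" .
  have "summable (\<lambda>n. parallelogram_defect (r n) x y)"
    unfolding parallelogram_defect_def by (intro summable_diff s summable_seminorm_squares)
  moreover have "0 \<le> parallelogram_defect (r n) x y" for n
    using parallelogram_defect_ge[of "r n", OF add nonneg] zero_le_power2 order_trans by blast
  ultimately show ?thesis unfolding eq using sum_le_suminf[of _ "{n}"] by fastforce
qed

lemma tendsto_parallelogram_defect:
  assumes x: "seminorm_sum r x = 1" and ys: "\<And>k. seminorm_sum r (ys k) \<le> 1"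
    and lim: "(\<lambda>k. seminorm_sum r (x + ys k)) \<longlonglongrightarrow> 2"
  shows "(\<lambda>k::nat. parallelogram_defect (r n) x (ys k)) \<longlonglongrightarrow> 0"
proof (rule tendsto_sandwich)
  show "\<forall>\<^sub>F k in sequentially. 0 \<le> parallelogram_defect (r n) x (ys k)"
    using parallelogram_defect_ge[of "r n", OF add nonneg] zero_le_power2 order_trans
    by (intro always_eventually) blast
  show "\<forall>\<^sub>F k in sequentially. parallelogram_defect (r n) x (ys k) \<le> 4 - (seminorm_sum r (x + ys k))\<^sup>2"
  proof (intro always_eventually allI)
    fix k
    have "(seminorm_sum r (ys k))\<^sup>2 \<le> 1" using ys seminorm_sum_nonneg by (intro power_le_one)
    then show "parallelogram_defect (r n) x (ys k) \<le> 4 - (seminorm_sum r (x + ys k))\<^sup>2"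
      using parallelogram_defect_le_seminorm_sum[of n x "ys k"] x
      by (simp add: parallelogram_defect_def)
  qed
  show "(\<lambda>k. 4 - (seminorm_sum r (x + ys k))\<^sup>2) \<longlonglongrightarrow> 0"
    using tendsto_diff[OF tendsto_const tendsto_power[OF lim, of 2], of 4] by simp
qed auto

end

section \<open>A weakly locally uniformly rotund norm on reflexive spaces\<close>

text \<open>Day's seminorm at level \<open>n\<close>, squared: the supremum stands for the sum of
  the \<open>n\<close> largest squared coordinates and needs no sorting.\<close>

definition top_squares :: "('a \<Rightarrow> real) set \<Rightarrow> nat \<Rightarrow> 'a \<Rightarrow> real" where
  "top_squares F n x = (SUP A\<in>{A. A \<subseteq> F \<and> finite A \<and> card A \<le> n}. \<Sum>f\<in>A. (f x)\<^sup>2)"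

text \<open>Passing from \<open>A\<close> to \<open>B\<close> adds terms of size at most
  \<open>s\<close> and drops terms of size at least \<open>t\<close>.\<close>

lemma sum_exchange_le:
  fixes u :: "'b \<Rightarrow> real"
  assumes fin: "finite A" "finite B" and A: "\<And>f. f \<in> A - B \<Longrightarrow> t \<le> u f"
    and B: "\<And>f. f \<in> B - A \<Longrightarrow> u f \<le> s"
  shows "sum u B \<le> sum u A + s * real (card (B - A)) - t * real (card (A - B))"
proof -
  have "sum u B = sum u (B \<inter> A) + sum u (B - A)" "sum u A = sum u (B \<inter> A) + sum u (A - B)"
    using sum.Int_Diff[OF fin(2), of u A] sum.Int_Diff[OF fin(1), of u B] by (auto simp: Int_commute)
  moreover have "sum u (B - A) \<le> real (card (B - A)) * s" using B by (intro sum_bounded_above) auto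
  moreover have "real (card (A - B)) * t \<le> sum u (A - B)" using A by (intro sum_bounded_below) auto
  ultimately show ?thesis by (simp add: mult.commute)
qed

lemma card_diff_diff:
  "finite A \<Longrightarrow> finite B \<Longrightarrow> card (B - A) + card A = card (A - B) + card B"
  by (metis card_Un_disjoint Diff_disjoint Un_Diff_cancel2 finite_Diff Un_commute inf_commute)

section \<open>Top squares and their defect for a separating family\<close>

context
  fixes F :: "('a::real_normed_vector \<Rightarrow> real) set"
  assumes F: "c0_separating UNIV F"
begin

lemma
  assumes "f \<in> F"
  shows F_add: "f (x + y) = f x + f y" and F_scaleR: "f (c *\<^sub>R x) = c * f x" and F_bound: "\<bar>f x\<bar> \<le> norm x"
  using c0_separatingD(1-3)[OF F assms] by auto

lemma F_finite: "e > 0 \<Longrightarrow> finite {f \<in> F. e < \<bar>f x\<bar>}"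
  using c0_separatingD(5)[OF F] by auto

lemma sum_squares_le:
  assumes "A \<subseteq> F" "finite A" "card A \<le> n"
  shows "(\<Sum>f\<in>A. (f x)\<^sup>2) \<le> real n * (norm x)\<^sup>2"
proof -
  have "(\<Sum>f\<in>A. (f x)\<^sup>2) \<le> real (card A) * (norm x)\<^sup>2"
    using assms F_bound by (intro sum_bounded_above) (auto simp: abs_le_square_iff[symmetric])
  also have "\<dots> \<le> real n * (norm x)\<^sup>2" using assms by (intro mult_right_mono) auto
  finally show ?thesis .
qed

lemma top_squares_bdd:
  "bdd_above ((\<lambda>A. \<Sum>f\<in>A. (f x)\<^sup>2) ` {A. A \<subseteq> F \<and> finite A \<and> card A \<le> n})"
  by (rule bdd_aboveI2[where M = "real n * (norm x)\<^sup>2"]) (auto intro: sum_squares_le)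

lemma sum_le_top_squares:
  "A \<subseteq> F \<Longrightarrow> finite A \<Longrightarrow> card A \<le> n \<Longrightarrow> (\<Sum>f\<in>A. (f x)\<^sup>2) \<le> top_squares F n x"
  unfolding top_squares_def by (intro cSUP_upper top_squares_bdd) auto

lemma top_squares_le:
  assumes "\<And>A. A \<subseteq> F \<Longrightarrow> finite A \<Longrightarrow> card A \<le> n \<Longrightarrow> (\<Sum>f\<in>A. (f x)\<^sup>2) \<le> c"
  shows "top_squares F n x \<le> c"
  unfolding top_squares_def
proof (rule cSUP_least)
  show "{A. A \<subseteq> F \<and> finite A \<and> card A \<le> n} \<noteq> {}" by (auto intro: exI[of _ "{}"])
qed (use assms in blast)

lemma top_squares_nonneg: "0 \<le> top_squares F n x"
  using sum_le_top_squares[of "{}" n x] by simp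

lemma top_squares_approx:
  assumes "e > 0"
  obtains A where "A \<subseteq> F" "finite A" "card A \<le> n" "top_squares F n x - e < (\<Sum>f\<in>A. (f x)\<^sup>2)"
proof -
  have "{A. A \<subseteq> F \<and> finite A \<and> card A \<le> n} \<noteq> {}" by (auto intro: exI[of _ "{}"])
  from less_cSUP_iff[OF this top_squares_bdd, of "top_squares F n x - e" x] assms
  show ?thesis using that unfolding top_squares_def by auto
qed

lemma top_squares_le_norm: "top_squares F n x \<le> real n * (norm x)\<^sup>2"
  by (intro top_squares_le sum_squares_le)

lemma sqrt_top_squares_add:
  "sqrt (top_squares F n (x + y)) \<le> sqrt (top_squares F n x) + sqrt (top_squares F n y)"
proof (rule real_le_lsqrt)
  show "top_squares F n (x + y) \<le> (sqrt (top_squares F n x) + sqrt (top_squares F n y))\<^sup>2"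
  proof (rule top_squares_le)
    fix A assume A: "A \<subseteq> F" "finite A" "card A \<le> n"
    have "L2_set (\<lambda>f. f (x + y)) A = L2_set (\<lambda>f. f x + f y) A"
      using A F_add by (intro L2_set_cong) auto
    also have "\<dots> \<le> L2_set (\<lambda>f. f x) A + L2_set (\<lambda>f. f y) A" by (rule L2_set_triangle_ineq)
    also have "\<dots> \<le> sqrt (top_squares F n x) + sqrt (top_squares F n y)"
      unfolding L2_set_def by (intro add_mono real_sqrt_le_mono sum_le_top_squares A)
    finally have "(L2_set (\<lambda>f. f (x + y)) A)\<^sup>2 \<le> (sqrt (top_squares F n x) + sqrt (top_squares F n y))\<^sup>2"
      by (intro power_mono) (simp_all add: L2_set_nonneg)
    then show "(\<Sum>f\<in>A. (f (x + y))\<^sup>2) \<le> (sqrt (top_squares F n x) + sqrt (top_squares F n y))\<^sup>2"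
      by (simp add: L2_set_def sum_nonneg)
  qed
qed (simp add: top_squares_nonneg)

lemma top_squares_scaleR: "top_squares F n (c *\<^sub>R x) = c\<^sup>2 * top_squares F n x"
proof -
  have sum: "(\<Sum>f\<in>A. (f (c *\<^sub>R x))\<^sup>2) = c\<^sup>2 * (\<Sum>f\<in>A. (f x)\<^sup>2)" if "A \<subseteq> F" for A c x
    unfolding sum_distrib_left using that by (intro sum.cong) (auto simp: power_mult_distrib F_scaleR[OF subsetD])
  have le: "top_squares F n (c *\<^sub>R x) \<le> c\<^sup>2 * top_squares F n x" for c x
    by (rule top_squares_le) (auto simp: sum intro!: mult_left_mono sum_le_top_squares)
  show ?thesis
  proof (cases "c = 0")
    case True
    then show ?thesis using le[of c x] top_squares_nonneg[of n "c *\<^sub>R x"] by simp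
  next
    case False
    have "c\<^sup>2 * top_squares F n x \<le> c\<^sup>2 * ((1 / c)\<^sup>2 * top_squares F n (c *\<^sub>R x))"
      using le[of "1 / c" "c *\<^sub>R x"] False by (intro mult_left_mono) auto
    also have "\<dots> = top_squares F n (c *\<^sub>R x)" using False by (simp add: power_divide)
    finally show ?thesis using le[of c x] by simp
  qed
qed

abbreviation top_defect :: "nat \<Rightarrow> 'a \<Rightarrow> 'a \<Rightarrow> real" where
  "top_defect n \<equiv> parallelogram_defect (\<lambda>x. sqrt (top_squares F n x))"

lemma top_defect_eq:
  "top_defect n x y = 2 * top_squares F n x + 2 * top_squares F n y - top_squares F n (x + y)"
  by (simp add: parallelogram_defect_def top_squares_nonneg)

text \<open>The set \<open>A\<close> of large coordinates of \<open>x\<close> beats every other set of at most as many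
  coordinates by a fixed gap, so a near-maximal set for \<open>x + y\<close> must be \<open>A\<close> when the defect is
  small.\<close>

lemma top_defect_controls_large_coordinates:
  fixes x :: 'a
  assumes e: "e > 0"
  defines "A \<equiv> {f \<in> F. e < \<bar>f x\<bar>}"
  obtains d where "d > 0"
    "\<And>y. top_defect (card A) x y < d \<Longrightarrow> (\<Sum>f\<in>A. (f x - f y)\<^sup>2) \<le> top_defect (card A) x y"
proof -
  have A: "finite A" "A \<subseteq> F" using F_finite[OF e] by (auto simp: A_def)
  have large: "e\<^sup>2 < (f x)\<^sup>2" if "f \<in> A" for f
    using that e power_strict_mono[of e "\<bar>f x\<bar>" 2] by (auto simp: A_def)
  have small: "(f x)\<^sup>2 \<le> e\<^sup>2" if "f \<in> F" "f \<notin> A" for f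
    using that e power_mono[of "\<bar>f x\<bar>" e 2] by (auto simp: A_def)
  \<comment> \<open>The least squared large coordinate of \<open>x\<close>, strictly above
    \<open>e\<^sup>2\<close> because \<open>A\<close> is finite; the inserted
    \<open>e\<^sup>2 + 1\<close> covers an empty \<open>A\<close>.\<close>
  define t where "t = Min (insert (e\<^sup>2 + 1) ((\<lambda>f. (f x)\<^sup>2) ` A))"
  have t: "t > e\<^sup>2" using A(1) large by (simp add: t_def)
  have tA: "t \<le> (f x)\<^sup>2" if "f \<in> A" for f using that A(1) by (simp add: t_def)
  define d where "d = t - e\<^sup>2"
  have d: "d > 0" using t by (simp add: d_def)
  have gap: "(\<Sum>f\<in>B. (f x)\<^sup>2) \<le> (\<Sum>f\<in>A. (f x)\<^sup>2) - d"
    if B: "B \<subseteq> F" "finite B" "card B \<le> card A" "B \<noteq> A" for B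
  proof -
    have le: "card (B - A) \<le> card (A - B)" using card_diff_diff[OF A(1) B(2)] B(3) by linarith
    have "A - B \<noteq> {}"
    proof
      assume "A - B = {}"
      then have "A \<subseteq> B" by blast
      then show False using card_seteq[OF B(2), of A] B(3,4) by blast
    qed
    then have pos: "1 \<le> real (card (A - B))" using A(1) by (simp add: Suc_le_eq card_gt_0_iff)
    have "(\<Sum>f\<in>B. (f x)\<^sup>2) \<le> (\<Sum>f\<in>A. (f x)\<^sup>2) + e\<^sup>2 * real (card (B - A)) - t * real (card (A - B))"
      using B A tA small by (intro sum_exchange_le) auto
    moreover have "e\<^sup>2 * real (card (B - A)) \<le> e\<^sup>2 * real (card (A - B))" using le by (intro mult_left_mono) auto
    moreover have "d * 1 \<le> d * real (card (A - B))" using pos d by (intro mult_left_mono) auto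
    ultimately show ?thesis by (simp add: d_def algebra_simps)
  qed
  have "(\<Sum>f\<in>A. (f x - f y)\<^sup>2) \<le> top_defect (card A) x y" if y: "top_defect (card A) x y < d" for y
  proof (rule field_le_epsilon)
    fix h :: real assume h: "h > 0"
    define m where "m = min h d"
    have m: "m > 0" "m \<le> h" "m \<le> d" using h d by (auto simp: m_def)
    obtain B where B: "B \<subseteq> F" "finite B" "card B \<le> card A"
      "top_squares F (card A) (x + y) - m < (\<Sum>f\<in>B. (f (x + y))\<^sup>2)"
      using top_squares_approx[OF m(1)] by blast
    have "(\<Sum>f\<in>B. (f x - f y)\<^sup>2) + (\<Sum>f\<in>B. (f (x + y))\<^sup>2) = 2 * (\<Sum>f\<in>B. (f x)\<^sup>2) + 2 * (\<Sum>f\<in>B. (f y)\<^sup>2)"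
      unfolding sum_distrib_left sum.distrib[symmetric]
      by (intro sum.cong) (auto simp: F_add[OF subsetD[OF B(1)]] power2_eq_square algebra_simps)
    moreover have "(\<Sum>f\<in>B. (f y)\<^sup>2) \<le> top_squares F (card A) y" by (intro sum_le_top_squares B)
    ultimately have main: "(\<Sum>f\<in>B. (f x - f y)\<^sup>2)
        \<le> 2 * (\<Sum>f\<in>B. (f x)\<^sup>2) + 2 * top_squares F (card A) y - top_squares F (card A) (x + y) + m"
      using B(4) by linarith
    have Ax: "(\<Sum>f\<in>A. (f x)\<^sup>2) \<le> top_squares F (card A) x" by (intro sum_le_top_squares A) simp
    \<comment> \<open>Otherwise the gap \<open>d\<close> enters twice, and outweighs the defect,
      which is below \<open>d\<close>, together with the tolerance \<open>m\<close>, which is at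
      most \<open>d\<close>.\<close>
    have "B = A"
    proof (rule ccontr)
      assume "B \<noteq> A"
      then have "(\<Sum>f\<in>B. (f x - f y)\<^sup>2) < 0"
        using main gap[OF B(1-3)] Ax y m(3) unfolding top_defect_eq by linarith
      moreover have "0 \<le> (\<Sum>f\<in>B. (f x - f y)\<^sup>2)" by (intro sum_nonneg) simp
      ultimately show False by linarith
    qed
    then show "(\<Sum>f\<in>A. (f x - f y)\<^sup>2) \<le> top_defect (card A) x y + h"
      using main Ax m(2) unfolding top_defect_eq by simp
  qed
  then show ?thesis using that d by blast
qed

lemma tendsto_large_coordinate:
  assumes lim: "\<And>n. (\<lambda>k::nat. top_defect n x (ys k)) \<longlonglongrightarrow> 0"
    and e: "e > 0" and f: "f \<in> F" "e < \<bar>f x\<bar>"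
  shows "(\<lambda>k. f (ys k)) \<longlonglongrightarrow> f x"
proof -
  define A where "A = {f \<in> F. e < \<bar>f x\<bar>}"
  have A: "finite A" "f \<in> A" using F_finite[OF e] f by (auto simp: A_def)
  obtain d where d: "d > 0"
    "\<And>y. top_defect (card A) x y < d \<Longrightarrow> (\<Sum>f\<in>A. (f x - f y)\<^sup>2) \<le> top_defect (card A) x y"
    using top_defect_controls_large_coordinates[OF e, of x] unfolding A_def by blast
  have "\<forall>\<^sub>F k in sequentially. top_defect (card A) x (ys k) < d"
    using order_tendstoD(2)[OF lim d(1)] .
  then have "\<forall>\<^sub>F k in sequentially. (f x - f (ys k))\<^sup>2 \<le> top_defect (card A) x (ys k)"
  proof (rule eventually_mono)
    fix k assume "top_defect (card A) x (ys k) < d"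
    moreover have "(f x - f (ys k))\<^sup>2 \<le> (\<Sum>f\<in>A. (f x - f (ys k))\<^sup>2)"
      using A by (intro member_le_sum) auto
    ultimately show "(f x - f (ys k))\<^sup>2 \<le> top_defect (card A) x (ys k)" using d(2) by force
  qed
  then have "(\<lambda>k. (f x - f (ys k))\<^sup>2) \<longlonglongrightarrow> 0"
    by (intro tendsto_sandwich[OF _ _ tendsto_const lim]) auto
  then have "(\<lambda>k. sqrt ((f x - f (ys k))\<^sup>2)) \<longlonglongrightarrow> sqrt 0" by (rule tendsto_real_sqrt)
  then have "(\<lambda>k. f x - f (ys k)) \<longlonglongrightarrow> 0" by (simp add: tendsto_rabs_zero_iff)
  then show ?thesis using tendsto_diff[OF tendsto_const[of "f x"]] by fastforce
qed

text \<open>A nonzero coordinate of \<open>x\<close> is a large one. If \<open>g x = 0\<close>, a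
  persistently large \<open>g (ys k)\<close> could be added to the large coordinates of
  \<open>x\<close> and would push the top squares of \<open>ys k\<close> beyond their limit.\<close>

lemma tendsto_coordinate:
  assumes lim: "\<And>n. (\<lambda>k::nat. top_defect n x (ys k)) \<longlonglongrightarrow> 0" and g: "g \<in> F"
  shows "(\<lambda>k. g (ys k)) \<longlonglongrightarrow> g x"
proof (cases "g x = 0")
  case False
  then show ?thesis using tendsto_large_coordinate[OF lim, of "\<bar>g x\<bar> / 2" g] g by simp
next
  case True
  have "\<forall>\<^sub>F k in sequentially. \<bar>g (ys k)\<bar> < 2 * e" if e: "e > 0" for e
  proof -
    define A where "A = {f \<in> F. e < \<bar>f x\<bar>}"
    \<comment> \<open>One more than the number of large coordinates, which leaves room for
      \<open>g\<close>.\<close>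
    define n where "n = Suc (card A)"
    have A: "finite A" "A \<subseteq> F" "g \<notin> A" using F_finite[OF e] True e by (auto simp: A_def)
    have large: "e\<^sup>2 \<le> (f x)\<^sup>2" if "f \<in> A" for f
      using that e power_mono[of e "\<bar>f x\<bar>" 2] by (auto simp: A_def)
    have small: "(f x)\<^sup>2 \<le> e\<^sup>2" if "f \<in> F" "f \<notin> A" for f
      using that e power_mono[of "\<bar>f x\<bar>" e 2] by (auto simp: A_def)
    have "top_squares F n x \<le> (\<Sum>f\<in>A. (f x)\<^sup>2) + e\<^sup>2"
    proof (rule top_squares_le)
      fix B assume B: "B \<subseteq> F" "finite B" "card B \<le> n"
      have "real (card (B - A)) \<le> real (card (A - B)) + 1"
        using card_diff_diff[OF A(1) B(2)] B(3) unfolding n_def by linarith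
      then have "e\<^sup>2 * real (card (B - A)) \<le> e\<^sup>2 * (real (card (A - B)) + 1)"
        by (intro mult_left_mono) auto
      moreover have "(\<Sum>f\<in>B. (f x)\<^sup>2)
          \<le> (\<Sum>f\<in>A. (f x)\<^sup>2) + e\<^sup>2 * real (card (B - A)) - e\<^sup>2 * real (card (A - B))"
        using B A large small by (intro sum_exchange_le) auto
      ultimately show "(\<Sum>f\<in>B. (f x)\<^sup>2) \<le> (\<Sum>f\<in>A. (f x)\<^sup>2) + e\<^sup>2" by (simp add: algebra_simps)
    qed
    then have up: "top_squares F n x - (\<Sum>f\<in>A. (f x)\<^sup>2) < (2 * e)\<^sup>2"
      using zero_less_power[OF e, of 2] unfolding power_mult_distrib power2_eq_square by linarith
    \<comment> \<open>A vanishing defect also forces the seminorm values to converge.\<close>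
    have "(\<lambda>k. (sqrt (top_squares F n x) - sqrt (top_squares F n (ys k)))\<^sup>2) \<longlonglongrightarrow> 0"
      using parallelogram_defect_ge[of "\<lambda>x. sqrt (top_squares F n x)", OF sqrt_top_squares_add]
      by (intro tendsto_sandwich[OF _ _ tendsto_const lim[of n]])
        (auto simp: top_squares_nonneg)
    then have "(\<lambda>k. sqrt ((sqrt (top_squares F n x) - sqrt (top_squares F n (ys k)))\<^sup>2)) \<longlonglongrightarrow> sqrt 0"
      by (rule tendsto_real_sqrt)
    then have "(\<lambda>k. sqrt (top_squares F n x) - sqrt (top_squares F n (ys k))) \<longlonglongrightarrow> 0"
      by (simp add: tendsto_rabs_zero_iff)
    then have "(\<lambda>k. sqrt (top_squares F n (ys k))) \<longlonglongrightarrow> sqrt (top_squares F n x)"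
      using tendsto_diff[OF tendsto_const[of "sqrt (top_squares F n x)"]] by fastforce
    then have "(\<lambda>k. (sqrt (top_squares F n (ys k)))\<^sup>2) \<longlonglongrightarrow> (sqrt (top_squares F n x))\<^sup>2"
      by (rule tendsto_power)
    then have "(\<lambda>k. top_squares F n (ys k)) \<longlonglongrightarrow> top_squares F n x" by (simp add: top_squares_nonneg)
    moreover have "(\<lambda>k. \<Sum>f\<in>A. (f (ys k))\<^sup>2) \<longlonglongrightarrow> (\<Sum>f\<in>A. (f x)\<^sup>2)"
      by (intro tendsto_sum tendsto_power tendsto_large_coordinate[OF lim e]) (auto simp: A_def)
    ultimately have "(\<lambda>k. top_squares F n (ys k) - (\<Sum>f\<in>A. (f (ys k))\<^sup>2))
        \<longlonglongrightarrow> top_squares F n x - (\<Sum>f\<in>A. (f x)\<^sup>2)" by (rule tendsto_diff)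
    then have "\<forall>\<^sub>F k in sequentially. top_squares F n (ys k) - (\<Sum>f\<in>A. (f (ys k))\<^sup>2) < (2 * e)\<^sup>2"
      using up by (rule order_tendstoD)
    then show ?thesis
    proof (rule eventually_mono)
      fix k assume k: "top_squares F n (ys k) - (\<Sum>f\<in>A. (f (ys k))\<^sup>2) < (2 * e)\<^sup>2"
      have "(\<Sum>f\<in>insert g A. (f (ys k))\<^sup>2) \<le> top_squares F n (ys k)"
        using A g by (intro sum_le_top_squares) (auto simp: n_def)
      then have "(g (ys k))\<^sup>2 < (2 * e)\<^sup>2" using A k by simp
      then show "\<bar>g (ys k)\<bar> < 2 * e" using e power2_less_imp_less[of "\<bar>g (ys k)\<bar>" "2 * e"] by simp
    qed
  qed
  note ev = this
  have "\<forall>\<^sub>F k in sequentially. dist (g (ys k)) (g x) < e" if "e > 0" for e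
    using ev[of "e / 2"] that True by (simp add: dist_real_def)
  then show ?thesis by (intro tendstoI)
qed

end

section \<open>Weak convergence and bidual norms\<close>

text \<open>The functionals along which \<open>ys\<close> converges to \<open>x\<close> form a
  subspace \<open>W\<close>, closed because \<open>ys\<close> is bounded. It is dense: by
  reflexivity a functional vanishing on \<open>W\<close> is evaluation at some \<open>z\<close>, and
  \<open>F\<close> inside \<open>W\<close> forces \<open>z = 0\<close>.\<close>

lemma tendsto_functional_of_separating:
  fixes x :: "'a::real_normed_vector" and g :: "'a \<Rightarrow>\<^sub>L real"
  assumes refl: "reflexive_space TYPE('a)" and F: "c0_separating UNIV F"
    and bound: "\<And>k. norm (ys k) \<le> C"
    and lim: "\<And>f. f \<in> F \<Longrightarrow> (\<lambda>k::nat. f (ys k)) \<longlonglongrightarrow> f x"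
  shows "(\<lambda>k. blinfun_apply g (ys k)) \<longlonglongrightarrow> blinfun_apply g x"
proof -
  define W where "W = {g :: 'a \<Rightarrow>\<^sub>L real. (\<lambda>k. blinfun_apply g (ys k)) \<longlonglongrightarrow> blinfun_apply g x}"
  have sub: "subspace W"
    by (rule subspaceI)
      (auto simp: W_def blinfun.add_left blinfun.scaleR_left intro: tendsto_add tendsto_mult)
  have C: "0 \<le> C" using bound[of 0] norm_ge_zero order_trans by blast
  have "g \<in> W" if g: "g \<in> closure W" for g
    unfolding W_def mem_Collect_eq
  proof (rule tendstoI)
    fix e :: real assume e: "e > 0"
    define d where "d = e / 2 / (C + norm x + 1)"
    have Cx: "C + norm x + 1 > 0" using C by (simp add: add_nonneg_pos)
    then have d: "d > 0" "d * (C + norm x + 1) = e / 2" using e unfolding d_def by (auto simp del: divide_divide_eq_left)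
    then have d': "d * (C + norm x) < e / 2" by (simp add: algebra_simps)
    obtain h where h: "h \<in> W" "dist h g < d"
      using g d(1) unfolding closure_approachable by blast
    have "\<forall>\<^sub>F k in sequentially. dist (blinfun_apply h (ys k)) (blinfun_apply h x) < e / 2"
      using h(1) e unfolding W_def mem_Collect_eq by (intro tendstoD) auto
    then show "\<forall>\<^sub>F k in sequentially. dist (blinfun_apply g (ys k)) (blinfun_apply g x) < e"
    proof (rule eventually_mono)
      fix k assume k: "dist (blinfun_apply h (ys k)) (blinfun_apply h x) < e / 2"
      have "\<bar>blinfun_apply (g - h) (ys k - x)\<bar> \<le> norm (g - h) * norm (ys k - x)"
        using norm_blinfun[of "g - h" "ys k - x"] by simp
      also have "\<dots> \<le> d * (C + norm x)"
        using d(1) h(2) bound[of k] norm_triangle_ineq4[of "ys k" x]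
        by (intro mult_mono) (auto simp: dist_norm norm_minus_commute)
      finally show "dist (blinfun_apply g (ys k)) (blinfun_apply g x) < e"
        using k d' unfolding dist_real_def blinfun.diff_left blinfun.diff_right by linarith
    qed
  qed
  moreover have "g \<in> closure W"
  proof (rule ccontr)
    assume "g \<notin> closure W"
    then obtain \<Phi> :: "('a \<Rightarrow>\<^sub>L real) \<Rightarrow>\<^sub>L real"
      where \<Phi>: "\<And>h. h \<in> W \<Longrightarrow> blinfun_apply \<Phi> h = 0" "blinfun_apply \<Phi> g \<noteq> 0"
      using subspace_separating_functional[OF sub] by blast
    obtain z where z: "\<Phi> = canonical_embedding z"
      using refl unfolding reflexive_space_def by (metis surjD)
    have "z = 0"
    proof (rule c0_separatingD(4)[OF F UNIV_I])
      fix f assume f: "f \<in> F"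
      have "bounded_linear f"
        using c0_separatingD(1-3)[OF F f] by (intro bounded_linear_intro[where K = 1]) auto
      then have eq: "blinfun_apply (Blinfun f) = f" by (rule bounded_linear_Blinfun_apply)
      then have "Blinfun f \<in> W" using lim[OF f] by (simp add: W_def)
      then show "f z = 0" using \<Phi>(1)[of "Blinfun f"] z eq by simp
    qed
    then show False using \<Phi>(2) z by simp
  qed
  ultimately show ?thesis unfolding W_def by blast
qed

text \<open>It suffices to test convergence on the generating sets; induction over the generated
  topology carries it through finite intersections and unions.\<close>

lemma limitin_weak_topology_iff:
  "limitin weak_topology ys (y :: 'b::real_normed_vector) G \<longleftrightarrow>
     (\<forall>f :: 'b \<Rightarrow>\<^sub>L real. ((\<lambda>n. blinfun_apply f (ys n)) \<longlongrightarrow> blinfun_apply f y) G)"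
proof (intro iffI allI)
  fix f :: "'b \<Rightarrow>\<^sub>L real" assume lim: "limitin weak_topology ys y G"
  show "((\<lambda>n. blinfun_apply f (ys n)) \<longlongrightarrow> blinfun_apply f y) G"
  proof (rule topological_tendstoI)
    fix V assume V: "open V" "blinfun_apply f y \<in> V"
    have "openin weak_topology (blinfun_apply f -` V)"
      unfolding weak_topology_def using V(1) by (intro topology_generated_by_Basis) blast
    then have "\<forall>\<^sub>F n in G. ys n \<in> blinfun_apply f -` V" using lim V(2) unfolding limitin_def by blast
    then show "\<forall>\<^sub>F n in G. blinfun_apply f (ys n) \<in> V" by simp
  qed
next
  assume lim: "\<forall>f :: 'b \<Rightarrow>\<^sub>L real. ((\<lambda>n. blinfun_apply f (ys n)) \<longlongrightarrow> blinfun_apply f y) G"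
  have ev: "y \<in> V \<longrightarrow> (\<forall>\<^sub>F n in G. ys n \<in> V)" if "openin weak_topology V" for V
    using that unfolding weak_topology_def openin_topology_generated_by_iff
  proof (induction rule: generate_topology_on.induct)
    case (Int a b)
    then show ?case by (simp add: eventually_conj_iff)
  next
    case (UN K)
    show ?case
    proof
      assume "y \<in> \<Union>K"
      then obtain k where "k \<in> K" "y \<in> k" by blast
      then have "\<forall>\<^sub>F n in G. ys n \<in> k" using UN.IH by blast
      then show "\<forall>\<^sub>F n in G. ys n \<in> \<Union>K" by (rule eventually_mono) (use \<open>k \<in> K\<close> in blast)
    qed
  next
    case (Basis s)
    then obtain f :: "'b \<Rightarrow>\<^sub>L real" and V where "s = blinfun_apply f -` V" "open V" by blast
    then show ?case using lim topological_tendstoD by fastforce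
  qed auto
  have "y \<in> topspace weak_topology"
    unfolding weak_topology_def topology_generated_by_topspace using open_UNIV by blast
  then show "limitin weak_topology ys y G" using ev unfolding limitin_def by blast
qed

section \<open>Dual and bidual norms of an equivalent norm\<close>

lemma dual_norm_least:
  assumes "equivalent_norm p" and "\<And>x. p x \<le> 1 \<Longrightarrow> \<bar>blinfun_apply f x\<bar> \<le> c"
  shows "dual_norm p f \<le> c"
  unfolding dual_norm_def
proof (rule cSUP_least)
  have "p 0 = 0" using assms(1) unfolding equivalent_norm_def by (metis abs_zero mult_zero_left scaleR_zero_left)
  then show "{x. p x \<le> 1} \<noteq> {}" by (auto intro: exI[of _ 0])
qed (use assms in auto)

lemma dual_norm_bdd:
  fixes f :: "'a::real_normed_vector \<Rightarrow>\<^sub>L real"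
  assumes "equivalent_norm p"
  shows "bdd_above ((\<lambda>x. \<bar>blinfun_apply f x\<bar>) ` {x. p x \<le> 1})"
proof -
  obtain c where c: "c > 0" "\<And>x. c * norm x \<le> p x" using assms unfolding equivalent_norm_def by blast
  show ?thesis
  proof (rule bdd_aboveI2)
    fix x assume "x \<in> {x. p x \<le> 1}"
    then have "norm x \<le> 1 / c" using c(2)[of x] c(1) by (simp add: field_simps)
    then have "norm f * norm x \<le> norm f * (1 / c)" by (intro mult_left_mono) auto
    then show "\<bar>blinfun_apply f x\<bar> \<le> norm f * (1 / c)" using norm_blinfun[of f x] by simp
  qed
qed

lemma dual_norm_upper:
  "equivalent_norm p \<Longrightarrow> p x \<le> 1 \<Longrightarrow> \<bar>blinfun_apply f x\<bar> \<le> dual_norm p f"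
  unfolding dual_norm_def by (intro cSUP_upper dual_norm_bdd) auto

lemma equivalent_normD:
  assumes "equivalent_norm p"
  shows "p (x + y) \<le> p x + p y" "p (a *\<^sub>R x) = \<bar>a\<bar> * p x" "0 \<le> p x" "p x = 0 \<longleftrightarrow> x = 0"
proof -
  obtain c C where c: "c > 0" "\<And>x. c * norm x \<le> p x" "\<And>x. p x \<le> C * norm x"
    using assms unfolding equivalent_norm_def by blast
  show "p (x + y) \<le> p x + p y" "p (a *\<^sub>R x) = \<bar>a\<bar> * p x"
    using assms unfolding equivalent_norm_def by blast+
  have "0 \<le> c * norm x" using c(1) by simp
  then show "0 \<le> p x" using c(2)[of x] by linarith
  show "p x = 0 \<longleftrightarrow> x = 0"
    using c(1) c(2)[of x] c(2)[of 0] c(3)[of 0] mult_pos_pos[of c "norm x"] by fastforce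
qed

lemma dual_norm_apply_le:
  assumes p: "equivalent_norm p"
  shows "\<bar>blinfun_apply f x\<bar> \<le> dual_norm p f * p x"
proof (cases "x = 0")
  case True
  then show ?thesis using equivalent_normD(4)[OF p, of x] by simp
next
  case False
  then have pos: "p x > 0" using equivalent_normD(3,4)[OF p, of x] by simp
  have "\<bar>blinfun_apply f ((1 / p x) *\<^sub>R x)\<bar> \<le> dual_norm p f"
    using pos by (intro dual_norm_upper[OF p]) (simp add: equivalent_normD(2)[OF p])
  then show ?thesis using pos by (simp add: blinfun.scaleR_right abs_mult field_simps)
qed

lemma equivalent_norm_bidual_norm: "equivalent_norm p \<Longrightarrow> equivalent_norm (bidual_norm p)"
  unfolding bidual_norm_def by (intro equivalent_norm_dual_norm)

text \<open>The lower bound uses a functional dominated by \<open>p\<close> that attains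
  \<open>p\<close> at \<open>x\<close>; its dual norm is at most 1.\<close>

lemma bidual_norm_canonical_embedding:
  assumes p: "equivalent_norm p"
  shows "bidual_norm p (canonical_embedding x) = p x"
proof (rule antisym)
  note dp = equivalent_norm_dual_norm[OF p]
  show "bidual_norm p (canonical_embedding x) \<le> p x"
    unfolding bidual_norm_def
  proof (rule dual_norm_least[OF dp])
    fix f assume f: "dual_norm p f \<le> 1"
    have "\<bar>blinfun_apply f x\<bar> \<le> dual_norm p f * p x" by (rule dual_norm_apply_le[OF p])
    also have "\<dots> \<le> 1 * p x" using f equivalent_normD(3)[OF p] by (intro mult_right_mono)
    finally show "\<bar>blinfun_apply (canonical_embedding x) f\<bar> \<le> p x" by simp
  qed
  obtain C where "\<And>x. p x \<le> C * norm x" using p unfolding equivalent_norm_def by blast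
  then obtain f :: "'a \<Rightarrow>\<^sub>L real" where f: "\<And>z. \<bar>blinfun_apply f z\<bar> \<le> p z" "blinfun_apply f x = p x"
    using seminorm_attaining_functional[of p C x, OF equivalent_normD(1)[OF p] equivalent_normD(2)[OF p]] by blast
  have "dual_norm p f \<le> 1" using f(1) by (intro dual_norm_least[OF p]) (blast intro: order_trans)
  then have "\<bar>blinfun_apply (canonical_embedding x) f\<bar> \<le> bidual_norm p (canonical_embedding x)"
    unfolding bidual_norm_def by (rule dual_norm_upper[OF dp])
  then show "p x \<le> bidual_norm p (canonical_embedding x)"
    using f(2) equivalent_normD(3)[OF p, of x] by simp
qed

section \<open>The equivalences\<close>

lemma parallelogram_defect_scale:
  "parallelogram_defect (\<lambda>x. c * r x) x y = c\<^sup>2 * parallelogram_defect r x y"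
  by (simp add: parallelogram_defect_def power_mult_distrib algebra_simps)

text \<open>The embedding is onto and isometric for \<open>p\<close>, so the claim is pulled back to
  the original space, where vanishing defects give convergence of the coordinates and hence weak
  convergence.\<close>

lemma reflexive_imp_weakly_LUR_bidual:
  assumes refl: "reflexive_space TYPE('a::real_normed_vector)"
  shows "\<exists>p :: 'a \<Rightarrow> real. equivalent_norm p \<and> weakly_LUR (bidual_norm p)"
proof -
  obtain F where F: "c0_separating (UNIV :: 'a set) F" using reflexive_imp_c0_separating[OF refl] by blast
  \<comment> \<open>The denominator absorbs the growth of \<open>sqrt (top_squares F n x)\<close> in
    \<open>n\<close>. The power is \<open>Suc n\<close> because index 0 of \<open>r\<close> is
    reserved for the norm.\<close>
  define w :: "nat \<Rightarrow> real" where "w n = (1 / 2) ^ Suc n / real (Suc n)" for n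
  define r where "r = case_nat norm (\<lambda>n x. w n * sqrt (top_squares F n x))"
  have w: "w n > 0" for n by (simp add: w_def)
  have r0: "r 0 x = norm x" and rS: "r (Suc n) x = w n * sqrt (top_squares F n x)" for n x
    by (simp_all add: r_def)
  have bound: "r n x \<le> (1 / 2) ^ n * norm x" for n x
  proof (cases n)
    case (Suc m)
    have "real m \<le> (real (Suc m))\<^sup>2" by (simp add: power2_eq_square algebra_simps)
    then have "real m * (norm x)\<^sup>2 \<le> (real (Suc m))\<^sup>2 * (norm x)\<^sup>2" by (intro mult_right_mono) auto
    then have "top_squares F m x \<le> (real (Suc m) * norm x)\<^sup>2"
      using top_squares_le_norm[OF F, of m x] unfolding power_mult_distrib by linarith
    then have "sqrt (top_squares F m x) \<le> real (Suc m) * norm x" by (intro real_le_lsqrt) auto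
    then have "w m * sqrt (top_squares F m x) \<le> w m * (real (Suc m) * norm x)"
      using w[of m] by (intro mult_left_mono) auto
    also have "w m * (real (Suc m) * norm x) = w m * real (Suc m) * norm x" by simp
    also have "w m * real (Suc m) = (1 / 2) ^ n"
      unfolding w_def Suc by (intro nonzero_eq_divide_eq[THEN iffD1]) simp_all
    finally show ?thesis using Suc rS by simp
  qed (simp add: r0)
  have add: "r n (x + y) \<le> r n x + r n y" for n x y
  proof (cases n)
    case (Suc m)
    show ?thesis unfolding Suc rS distrib_left[symmetric]
      using w[of m] sqrt_top_squares_add[OF F] by (intro mult_left_mono) auto
  qed (simp add: r0 norm_triangle_ineq)
  have hom: "r n (t *\<^sub>R x) = \<bar>t\<bar> * r n x" for n t x
    by (cases n) (auto simp: r0 rS top_squares_scaleR[OF F] real_sqrt_mult)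
  have nonneg: "0 \<le> r n x" for n x
    by (cases n) (auto simp: r0 rS top_squares_nonneg[OF F] less_imp_le[OF w])
  define p where "p = seminorm_sum r"
  have p: "equivalent_norm p"
    unfolding p_def by (rule equivalent_norm_seminorm_sum[of r, OF add hom nonneg bound r0])
  have "limitin weak_topology \<phi>s \<phi> sequentially"
    if \<phi>: "bidual_norm p \<phi> = 1" and \<phi>s: "\<forall>n. bidual_norm p (\<phi>s n) \<le> 1"
      and lim: "(\<lambda>n. bidual_norm p (\<phi> + \<phi>s n)) \<longlonglongrightarrow> 2" for \<phi> \<phi>s
  proof -
    have surj: "surj (canonical_embedding :: 'a \<Rightarrow> _)" using refl unfolding reflexive_space_def .
    obtain x where x: "\<phi> = canonical_embedding x" using surj by (metis surjD)
    define ys where "ys n = inv canonical_embedding (\<phi>s n)" for n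
    have ys: "\<phi>s n = canonical_embedding (ys n)" for n unfolding ys_def by (simp add: surj_f_inv_f[OF surj])
    have ev_add: "canonical_embedding a + canonical_embedding b = canonical_embedding (a + b)" for a b :: 'a
      by (rule blinfun_eqI) (simp add: blinfun.add_left blinfun.add_right)
    note ev = bidual_norm_canonical_embedding[OF p]
    have px: "p x = 1" and pys: "\<And>n. p (ys n) \<le> 1" and plim: "(\<lambda>n. p (x + ys n)) \<longlonglongrightarrow> 2"
      using \<phi> \<phi>s lim by (simp_all add: x ys ev ev_add)
    have defect: "(\<lambda>k. parallelogram_defect (r n) x (ys k)) \<longlonglongrightarrow> 0" for n
      using tendsto_parallelogram_defect[of r, OF add hom nonneg bound r0] px pys plim
      unfolding p_def by blast
    have top: "(\<lambda>k. parallelogram_defect (\<lambda>x. sqrt (top_squares F n x)) x (ys k)) \<longlonglongrightarrow> 0" for n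
    proof -
      have "r (Suc n) = (\<lambda>x. w n * sqrt (top_squares F n x))" using rS by blast
      then have "(\<lambda>k. (w n)\<^sup>2 * parallelogram_defect (\<lambda>x. sqrt (top_squares F n x)) x (ys k)) \<longlonglongrightarrow> 0"
        using defect[of "Suc n"] by (simp add: parallelogram_defect_scale)
      then have "(\<lambda>k. (1 / (w n)\<^sup>2) * ((w n)\<^sup>2 *
          parallelogram_defect (\<lambda>x. sqrt (top_squares F n x)) x (ys k))) \<longlonglongrightarrow> (1 / (w n)\<^sup>2) * 0"
        by (intro tendsto_mult tendsto_const)
      then show ?thesis using w[of n] by simp
    qed
    have bdd: "norm (ys k) \<le> 1" for k
    proof -
      have "(r 0 (ys k))\<^sup>2 \<le> (p (ys k))\<^sup>2"
        unfolding p_def seminorm_sum_square[of r, OF add hom nonneg bound r0]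
        using sum_le_suminf[OF summable_seminorm_squares[of r, OF add hom nonneg bound r0], of "{0}" "ys k"]
        by simp
      also have "\<dots> \<le> 1" using pys equivalent_normD(3)[OF p] by (intro power_le_one)
      finally show ?thesis by (simp add: r0 power2_le_iff_abs_le abs_square_le_1)
    qed
    have conv: "(\<lambda>k. blinfun_apply g (ys k)) \<longlonglongrightarrow> blinfun_apply g x" for g :: "'a \<Rightarrow>\<^sub>L real"
      by (rule tendsto_functional_of_separating[where ys = ys, OF refl F bdd tendsto_coordinate[OF F top]])
    have ev_lin: "bounded_linear (canonical_embedding :: 'a \<Rightarrow> _)"
      unfolding canonical_embedding_def by (rule blinfun.bounded_linear_prod_left)
    show ?thesis unfolding limitin_weak_topology_iff
    proof
      fix \<Psi> :: "(('a \<Rightarrow>\<^sub>L real) \<Rightarrow>\<^sub>L real) \<Rightarrow>\<^sub>L real"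
      \<comment> \<open>A functional on the bidual is composed with the embedding to become a
        functional on the original space.\<close>
      have "blinfun_apply (\<Psi> o\<^sub>L Blinfun canonical_embedding) z = blinfun_apply \<Psi> (canonical_embedding z)" for z
        by (simp add: bounded_linear_Blinfun_apply[OF ev_lin])
      then show "(\<lambda>n. blinfun_apply \<Psi> (\<phi>s n)) \<longlonglongrightarrow> blinfun_apply \<Psi> \<phi>"
        using conv[of "\<Psi> o\<^sub>L Blinfun canonical_embedding"] by (simp add: x ys)
    qed
  qed
  then have "weakly_LUR (bidual_norm p)" unfolding weakly_LUR_def by blast
  then show ?thesis using p by blast
qed

text \<open>Terms whose norms approach the supremum 2 converge weakly to \<open>\<phi>\<close>, and
  a functional that separates \<open>\<phi>\<close> from the closed span would contradict
  this.\<close>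

lemma weakly_LUR_imp_Lambda_set:
  fixes q :: "'b::real_normed_vector \<Rightarrow> real"
  assumes q: "equivalent_norm q" and LUR: "weakly_LUR q" and \<phi>: "q \<phi> = 1"
  shows "\<phi> \<in> Lambda_set q"
  unfolding Lambda_set_def
proof (intro CollectI conjI allI impI \<phi>)
  fix \<phi>s :: "nat \<Rightarrow> 'b"
  assume \<phi>s: "\<forall>n. q (\<phi>s n) = 1" and sup: "(SUP n. q (\<phi> + \<phi>s n)) = 2"
  have le2: "q (\<phi> + \<phi>s n) \<le> 2" for n using equivalent_normD(1)[OF q, of \<phi> "\<phi>s n"] \<phi> \<phi>s by simp
  then have bdd: "bdd_above (range (\<lambda>n. q (\<phi> + \<phi>s n)))" by (intro bdd_aboveI2)
  have "\<exists>n. 2 - 1 / real (Suc k) < q (\<phi> + \<phi>s n)" for k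
    using less_cSUP_iff[OF _ bdd, of "2 - 1 / real (Suc k)"] sup by simp
  \<comment> \<open>The choice \<open>m\<close> need not be increasing: the supremum may be attained
    at a single index.\<close>
  then obtain m where m: "\<And>k. 2 - 1 / real (Suc k) < q (\<phi> + \<phi>s (m k))" by metis
  have "(\<lambda>k. 2 - 1 / real (Suc k)) \<longlonglongrightarrow> 2 - 0"
    using LIMSEQ_inverse_real_of_nat by (intro tendsto_diff tendsto_const) (simp add: inverse_eq_divide)
  then have "(\<lambda>k. 2 - 1 / real (Suc k)) \<longlonglongrightarrow> 2" by simp
  then have "(\<lambda>k. q (\<phi> + \<phi>s (m k))) \<longlonglongrightarrow> 2"
    by (rule tendsto_sandwich[OF always_eventually always_eventually _ tendsto_const, rotated 2])
      (use m le2 less_imp_le in blast)+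
  then have "limitin weak_topology (\<lambda>k. \<phi>s (m k)) \<phi> sequentially"
    using LUR \<phi> \<phi>s unfolding weakly_LUR_def by simp
  then have conv: "(\<lambda>k. blinfun_apply f (\<phi>s (m k))) \<longlonglongrightarrow> blinfun_apply f \<phi>" for f :: "'b \<Rightarrow>\<^sub>L real"
    unfolding limitin_weak_topology_iff by blast
  show "\<phi> \<in> closed_span (range \<phi>s)"
    unfolding closed_span_def
  proof (rule ccontr)
    assume "\<phi> \<notin> closure (span (range \<phi>s))"
    then obtain f :: "'b \<Rightarrow>\<^sub>L real"
      where f: "\<And>a. a \<in> span (range \<phi>s) \<Longrightarrow> blinfun_apply f a = 0" "blinfun_apply f \<phi> \<noteq> 0"
      using subspace_separating_functional[OF subspace_span] by blast
    then have "(\<lambda>k. blinfun_apply f (\<phi>s (m k))) = (\<lambda>k. 0)" by (simp add: span_base)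
    then show False using conv[of f] f(2) LIMSEQ_unique[OF tendsto_const] by metis
  qed
qed

lemma weakly_LUR_imp_closed_span_Lambda_set:
  fixes q :: "'b::real_normed_vector \<Rightarrow> real"
  assumes q: "equivalent_norm q" and LUR: "weakly_LUR q"
  shows "closed_span (Lambda_set q) = UNIV"
proof -
  have "\<phi> \<in> span (Lambda_set q)" for \<phi>
  proof (cases "\<phi> = 0")
    case False
    then have pos: "q \<phi> > 0" using equivalent_normD(3,4)[OF q, of \<phi>] by simp
    then have "(1 / q \<phi>) *\<^sub>R \<phi> \<in> Lambda_set q"
      by (intro weakly_LUR_imp_Lambda_set[OF q LUR]) (simp add: equivalent_normD(2)[OF q])
    then have "q \<phi> *\<^sub>R (1 / q \<phi>) *\<^sub>R \<phi> \<in> span (Lambda_set q)" by (intro span_scale span_base)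
    then show ?thesis using pos by simp
  qed (simp add: span_zero)
  then show ?thesis unfolding closed_span_def using closure_subset by fast
qed

text \<open>A functional \<open>f\<close> in the dual ball almost norms \<open>\<phi>\<close>, and a
  unit vector \<open>x\<close> almost norms \<open>f\<close>. Evaluating
  \<open>\<phi> + canonical_embedding x\<close> at \<open>f\<close> gives nearly 2, so such vectors
  form a test sequence for \<open>\<phi>\<close>.\<close>

lemma Lambda_set_in_closed_span_canonical:
  fixes p :: "'a::real_normed_vector \<Rightarrow> real"
  assumes p: "equivalent_norm p" and \<phi>: "\<phi> \<in> Lambda_set (bidual_norm p)"
  obtains xs where "\<phi> \<in> closed_span (canonical_embedding ` range (xs :: nat \<Rightarrow> 'a))"
proof -
  let ?q = "bidual_norm p"
  note dp = equivalent_norm_dual_norm[OF p]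
  note q = equivalent_norm_bidual_norm[OF p]
  have q\<phi>: "?q \<phi> = 1" using \<phi> by (simp add: Lambda_set_def)
  have "\<exists>x. p x = 1 \<and> 2 - 1 / real (Suc n) < ?q (\<phi> + canonical_embedding x)" for n
  proof -
    \<comment> \<open>Each of the two approximations costs \<open>e\<close>; the bound
      \<open>e \<le> 1 / 2\<close> keeps \<open>blinfun_apply f z\<close> positive.\<close>
    define e where "e = 1 / (2 * real (Suc n))"
    have e: "0 < e" "e \<le> 1 / 2" "2 * e = 1 / real (Suc n)" by (auto simp: e_def field_simps)
    have ne: "{x. s x \<le> 1} \<noteq> {}" if "equivalent_norm s" for s :: "'c::real_normed_vector \<Rightarrow> real"
      using equivalent_normD(4)[OF that, of 0] by (auto intro: exI[of _ 0])
    have almost: "\<exists>x. s x \<le> 1 \<and> 1 - e < blinfun_apply f x"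
      if s: "equivalent_norm s" and f: "1 - e < dual_norm s f"
      for s :: "'c::real_normed_vector \<Rightarrow> real" and f
    proof -
      obtain x where x: "s x \<le> 1" "1 - e < \<bar>blinfun_apply f x\<bar>"
        using f less_cSUP_iff[OF ne[OF s] dual_norm_bdd[OF s]] unfolding dual_norm_def by blast
      show ?thesis
      proof (cases "0 \<le> blinfun_apply f x")
        case False
        then have "s (- x) \<le> 1 \<and> 1 - e < blinfun_apply f (- x)"
          using x equivalent_normD(2)[OF s, of "-1" x] by (simp add: blinfun.minus_right)
        then show ?thesis by blast
      qed (use x in auto)
    qed
    obtain f where f: "dual_norm p f \<le> 1" "1 - e < blinfun_apply \<phi> f"
      using almost[OF dp, of \<phi>] q\<phi> e(1) unfolding bidual_norm_def by auto
    have "blinfun_apply \<phi> f \<le> dual_norm p f"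
      using dual_norm_apply_le[OF dp, of \<phi> f] q\<phi> unfolding bidual_norm_def by simp
    then obtain z where z: "p z \<le> 1" "1 - e < blinfun_apply f z" using almost[OF p, of f] f(2) by auto
    then have fz: "blinfun_apply f z > 0" using e by linarith
    then have pz: "p z > 0" using equivalent_normD(3,4)[OF p, of z] by auto
    \<comment> \<open>Moving \<open>z\<close> from the ball to the sphere only increases the
      positive value of \<open>f\<close>.\<close>
    define x where "x = (1 / p z) *\<^sub>R z"
    have px: "p x = 1" using pz by (simp add: x_def equivalent_normD(2)[OF p])
    have "blinfun_apply f z \<le> blinfun_apply f x"
      using fz pz z(1) by (simp add: x_def blinfun.scaleR_right field_simps)
    then have "2 - 2 * e < blinfun_apply (\<phi> + canonical_embedding x) f"
      using f(2) z(2) by (simp add: blinfun.add_left)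
    also have "\<dots> \<le> ?q (\<phi> + canonical_embedding x)"
      using dual_norm_upper[OF dp f(1), of "\<phi> + canonical_embedding x"] unfolding bidual_norm_def by simp
    finally show ?thesis using px e(3) by auto
  qed
  then obtain xs where xs: "\<And>n. p (xs n) = 1"
    "\<And>n. 2 - 1 / real (Suc n) < ?q (\<phi> + canonical_embedding (xs n))" by metis
  have qxs: "?q (canonical_embedding (xs n)) = 1" for n
    using xs(1) bidual_norm_canonical_embedding[OF p] by simp
  have le2: "?q (\<phi> + canonical_embedding (xs n)) \<le> 2" for n
    using equivalent_normD(1)[OF q, of \<phi> "canonical_embedding (xs n)"] q\<phi> qxs by simp
  have "(SUP n. ?q (\<phi> + canonical_embedding (xs n))) = 2"
  proof (rule antisym)
    show "(SUP n. ?q (\<phi> + canonical_embedding (xs n))) \<le> 2" using le2 by (intro cSUP_least) auto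
    show "2 \<le> (SUP n. ?q (\<phi> + canonical_embedding (xs n)))"
    proof (rule field_le_epsilon)
      fix d :: real assume "d > 0"
      then obtain n where n: "1 / real (Suc n) < d" using nat_approx_posE by blast
      have "?q (\<phi> + canonical_embedding (xs n)) \<le> (SUP n. ?q (\<phi> + canonical_embedding (xs n)))"
        using le2 by (intro cSUP_upper bdd_aboveI2) auto
      then show "2 \<le> (SUP n. ?q (\<phi> + canonical_embedding (xs n))) + d" using xs(2)[of n] n by linarith
    qed
  qed
  then have "\<phi> \<in> closed_span (range (\<lambda>n. canonical_embedding (xs n)))"
    using \<phi> qxs unfolding Lambda_set_def by simp
  then show ?thesis using that[of xs] by (simp add: image_image)
qed

lemma norm_canonical_embedding: "norm (canonical_embedding x) = norm x"
proof (rule antisym)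
  show "norm (canonical_embedding x) \<le> norm x"
  proof (rule norm_blinfun_bound)
    show "norm (blinfun_apply (canonical_embedding x) f) \<le> norm x * norm f" for f
      using norm_blinfun[of f x] by (simp add: mult.commute)
  qed simp
  obtain f :: "'a \<Rightarrow>\<^sub>L real" where f: "norm f \<le> 1" "blinfun_apply f x = norm x"
    by (rule norm_attaining_functional)
  have "norm x \<le> norm (canonical_embedding x) * norm f"
    using norm_blinfun[of "canonical_embedding x" f] f(2) by simp
  also have "\<dots> \<le> norm (canonical_embedding x) * 1" using f(1) by (intro mult_left_mono) auto
  finally show "norm x \<le> norm (canonical_embedding x)" by simp
qed

text \<open>Completeness of the space enters here: its isometric image is complete, hence
  closed.\<close>

lemma closed_range_canonical_embedding:
  "closed (range (canonical_embedding :: 'a::banach \<Rightarrow> _))"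
proof -
  have lin: "bounded_linear (canonical_embedding :: 'a \<Rightarrow> _)"
    unfolding canonical_embedding_def by (rule blinfun.bounded_linear_prod_left)
  have "complete (range (canonical_embedding :: 'a \<Rightarrow> _))"
    by (rule complete_isometric_image[OF zero_less_one subspace_UNIV lin])
      (auto simp: norm_canonical_embedding complete_UNIV)
  then show ?thesis by (rule complete_imp_closed)
qed

text \<open>The range of the embedding is a closed subspace, so once it contains
  \<open>Lambda_set (bidual_norm p)\<close> it contains the closed span as well.\<close>

lemma closed_span_Lambda_set_imp_reflexive:
  fixes p :: "'a::banach \<Rightarrow> real"
  assumes p: "equivalent_norm p" and span: "closed_span (Lambda_set (bidual_norm p)) = UNIV"
  shows "reflexive_space TYPE('a)"
proof -
  let ?R = "range (canonical_embedding :: 'a \<Rightarrow> _)"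
  have "linear (canonical_embedding :: 'a \<Rightarrow> _)"
    unfolding canonical_embedding_def
    by (rule bounded_linear.linear[OF blinfun.bounded_linear_prod_left])
  then have R: "subspace ?R" by (rule linear_subspace_image[OF _ subspace_UNIV])
  have min: "closed_span A \<subseteq> ?R" if "A \<subseteq> ?R" for A
    unfolding closed_span_def
    by (intro closure_minimal span_minimal that R closed_range_canonical_embedding)
  have "Lambda_set (bidual_norm p) \<subseteq> ?R"
  proof
    fix \<phi> assume "\<phi> \<in> Lambda_set (bidual_norm p)"
    then obtain xs where "\<phi> \<in> closed_span (canonical_embedding ` range (xs :: nat \<Rightarrow> 'a))"
      using Lambda_set_in_closed_span_canonical[OF p] by blast
    then show "\<phi> \<in> ?R" using min[of "canonical_embedding ` range xs"] by blast
  qed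
  then have "UNIV \<subseteq> ?R" using min span by blast
  then show ?thesis unfolding reflexive_space_def by blast
qed

theorem theorem2p4:
  shows "(reflexive_space TYPE('a::banach) \<longleftrightarrow>
            (\<exists>p :: 'a \<Rightarrow> real. equivalent_norm p \<and> weakly_LUR (bidual_norm p))) \<and>
         (reflexive_space TYPE('a) \<longleftrightarrow>
            (\<exists>p :: 'a \<Rightarrow> real. equivalent_norm p \<and>
               closed_span (Lambda_set (bidual_norm p)) = UNIV))"
  using reflexive_imp_weakly_LUR_bidual[where 'a = 'a] closed_span_Lambda_set_imp_reflexive[where 'a = 'a]
    weakly_LUR_imp_closed_span_Lambda_set[OF equivalent_norm_bidual_norm, where ?'a1 = 'a]
  by blast

end
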